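(* Let $\Xi$ be a compact subset of $\mathbb{R}^k$, let $f : \Xi \to \mathbb{R}$ be a continuous function, let $\mathbb{P} \in \mathcal{P}(\Xi)$, and let $\beta \in (0,1)$, $m > 0$, $\varepsilon > 0$, $\sigma > 0$. Let $$\mathcal{A}_{\mathrm{W}} = \left\{ \mathbb{Q} \in \mathcal{P}(\Xi) : \ W_\varepsilon(\mathbb{P},\mathbb{Q}) \leq m \right\},$$ where $W_\varepsilon$ is the entropy-regularized Wasserstein distance with ground cost $c(\xi,\zeta) = |\xi-\zeta|^2$ and reference coupling $\pi_0 = \mathbb{P}(\xi)\otimes\nu_\xi(\zeta)$. Then $$\sup_{\mathbb{Q} \in \mathcal{A}_{\mathrm{W}}} \min_{\alpha \in \mathbb{R}} \left( \alpha + \frac{1}{1-\beta} \int_{\Xi} [f(\xi)-\alpha]_+ \, \mathrm{d}\mathbb{Q}(\xi) \right) = \inf_{\substack{\lambda \geq 0, \\ \alpha \in \mathbb{R}}} \left( \alpha + \frac{\lambda m}{1-\beta} + \frac{\lambda\varepsilon}{1-\beta} \int_{\Xi} \log\left( \int_{\Xi} e^{\frac{[f(\zeta)-\alpha]_+ - \lambda c(\xi,\zeta)}{\lambda\varepsilon}} \, \mathrm{d}\nu_\xi(\zeta) \right) \mathrm{d}\mathbb{P}(\xi) \right).$$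
   Context: $\mathcal{P}(X)$ is the set of (Borel) probability measures on $X$; $|\cdot|$ is the Euclidean norm; $[t]_+ = \max(t,0)$. For $\xi \in \Xi$, $\nu_\xi \in \mathcal{P}(\Xi)$ is the probability measure $$\mathrm{d}\nu_\xi(\zeta) = \alpha_\xi\, e^{-\frac{|\xi-\zeta|^2}{2\sigma^2}} \mathbf{1}_{\Xi}(\zeta)\, \mathrm{d}\zeta,$$ where $\alpha_\xi > 0$ is the normalization constant ($\Xi$ is assumed to have positive Lebesgue measure). The reference coupling $\pi_0 \in \mathcal{P}(\Xi\times\Xi)$ is defined by $$\int_{\Xi\times\Xi} \varphi(\xi,\zeta)\, \mathrm{d}\pi_0(\xi,\zeta) = \int_{\Xi}\left( \int_{\Xi} \varphi(\xi,\zeta)\, \mathrm{d}\nu_\xi(\zeta) \right) \mathrm{d}\mathbb{P}(\xi) \quad \text{for all continuous } \varphi : \Xi\times\Xi \to \mathbb{R}.$$ The entropy of a coupling $\pi \in \mathcal{P}(\Xi\times\Xi)$ is $$H(\pi) = \begin{cases} \displaystyle\int_{\Xi\times\Xi} \log\frac{\mathrm{d}\pi}{\mathrm{d}\pi_0}\, \mathrm{d}\pi & \text{if } \pi \text{ is absolutely continuous with respect to } \pi_0, \\ +\infty & \text{otherwise.}\end{cases}$$ The entropy-regularized Wasserstein distance (here with the nominal law $\mathbb{P}$ as first argument) is $$W_\varepsilon(\mathbb{P},\mathbb{Q}) = \min\left\{ \int_{\Xi\times\Xi} c(\xi,\zeta)\, \mathrm{d}\pi(\xi,\zeta) + \varepsilon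 H(\pi) : \ \pi \in \mathcal{P}(\Xi\times\Xi),\ \pi_1 = \mathbb{P},\ \pi_2 = \mathbb{Q} \right\},$$ where $\pi_1$ and $\pi_2$ are the first and second marginals of $\pi$; its value is $+\infty$ if no admissible $\pi$ has finite entropy. In the infimum on the right-hand side, the value at $\lambda = 0$ is understood as the limit as $\lambda \to 0^+$. The supremum over an empty set is $-\infty$. *)

theory Defs
  imports "HOL-Probability.Probability"
begin

abbreviation borel_of :: "'a::topological_space set \<Rightarrow> 'a measure" where
  "borel_of X \<equiv> restrict_space borel X"

definition prob_measures :: "'a::topological_space set \<Rightarrow> 'a measure set" where
  "prob_measures X = {M. sets M = sets (borel_of X) \<and> prob_space M}"

text \<open>The measure \<open>\<nu>\<^sub>\<xi>\<close>: a Gaussian of variance \<open>\<sigma>\<^sup>2\<close> centred at \<open>\<xi>\<close>, truncated to \<open>\<Xi>\<close> and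
  renormalized.\<close>

definition gauss_norm_const :: "real \<Rightarrow> 'a::euclidean_space set \<Rightarrow> 'a \<Rightarrow> real" where
  "gauss_norm_const \<sigma> \<Xi> \<xi> =
     1 / (\<integral>\<zeta>. exp (- ((norm (\<xi> - \<zeta>))\<^sup>2 / (2 * \<sigma>\<^sup>2))) \<partial>restrict_space lborel \<Xi>)"

definition gauss_kernel :: "real \<Rightarrow> 'a::euclidean_space set \<Rightarrow> 'a \<Rightarrow> 'a measure" where
  "gauss_kernel \<sigma> \<Xi> \<xi> = density (restrict_space lborel \<Xi>)
     (\<lambda>\<zeta>. ennreal (gauss_norm_const \<sigma> \<Xi> \<xi> * exp (- ((norm (\<xi> - \<zeta>))\<^sup>2 / (2 * \<sigma>\<^sup>2)))))"

text \<open>The coupling \<open>P(\<xi>) \<otimes> \<nu>\<^sub>\<xi>(\<zeta>)\<close>: draw \<open>\<xi>\<close> from \<open>P\<close>, then \<open>\<zeta>\<close> from \<open>\<nu>\<^sub>\<xi>\<close>. The lemmas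
  \<open>ref_coupling_in_prob_measures\<close>, \<open>integral_ref_coupling\<close> and \<open>ref_coupling_unique\<close> below show
  that it is the only Borel probability measure \<open>M\<close> on \<open>\<Xi> \<times> \<Xi>\<close> with
  \<open>\<integral> \<phi> dM = \<integral> (\<integral> \<phi>(\<xi>, \<zeta>) d\<nu>\<^sub>\<xi>(\<zeta>)) dP(\<xi>)\<close> for all continuous \<open>\<phi>\<close>.\<close>

definition ref_coupling ::
    "real \<Rightarrow> 'a::euclidean_space set \<Rightarrow> 'a measure \<Rightarrow> ('a \<times> 'a) measure" where
  "ref_coupling \<sigma> \<Xi> P =
     P \<bind> (\<lambda>\<xi>. distr (gauss_kernel \<sigma> \<Xi> \<xi>) (borel_of (\<Xi> \<times> \<Xi>)) (\<lambda>\<zeta>. (\<xi>, \<zeta>)))"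

text \<open>Integral with values in the extended reals. The Bochner integral is not used for the entropy
  because it is \<open>0\<close> on non-integrable functions, where the entropy is \<open>\<infinity>\<close>.\<close>

definition ext_integral :: "'a measure \<Rightarrow> ('a \<Rightarrow> real) \<Rightarrow> ereal" where
  "ext_integral M g =
     enn2ereal (\<integral>\<^sup>+x. ennreal (g x) \<partial>M) - enn2ereal (\<integral>\<^sup>+x. ennreal (- g x) \<partial>M)"

text \<open>The density is finite and positive \<open>\<pi>\<close>-almost everywhere, so the values of \<open>enn2real\<close> at
  \<open>\<infinity>\<close> and of \<open>ln\<close> at \<open>0\<close> do not matter. For probability measures the
  negative part of the integrand has a finite integral.\<close>

definition rel_entropy :: "'a measure \<Rightarrow> 'a measure \<Rightarrow> ereal" where
  "rel_entropy \<pi>0 \<pi> =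
     (if absolutely_continuous \<pi>0 \<pi>
      then ext_integral \<pi> (\<lambda>x. ln (enn2real (RN_deriv \<pi>0 \<pi> x)))
      else \<infinity>)"

definition couplings ::
    "'a::topological_space set \<Rightarrow> 'a measure \<Rightarrow> 'a measure \<Rightarrow> ('a \<times> 'a) measure set" where
  "couplings \<Xi> P Q = {\<pi> \<in> prob_measures (\<Xi> \<times> \<Xi>).
     distr \<pi> (borel_of \<Xi>) fst = P \<and> distr \<pi> (borel_of \<Xi>) snd = Q}"

text \<open>The minimal transport cost is taken as an infimum in the extended reals, so it is \<open>\<infinity>\<close> exactly
  when no coupling has finite cost, and equals the minimum whenever that is attained.\<close>

definition entropic_wasserstein ::
    "('a::topological_space \<Rightarrow> 'a \<Rightarrow> real) \<Rightarrow> real \<Rightarrow> ('a \<times> 'a) measure \<Rightarrow> 'a set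
      \<Rightarrow> 'a measure \<Rightarrow> 'a measure \<Rightarrow> ereal" where
  "entropic_wasserstein c \<epsilon> \<pi>0 \<Xi> P Q =
     (INF \<pi> \<in> couplings \<Xi> P Q.
        ereal (\<integral>(\<xi>, \<zeta>). c \<xi> \<zeta> \<partial>\<pi>) + ereal \<epsilon> * rel_entropy \<pi>0 \<pi>)"

definition sq_dist_cost :: "'a::real_normed_vector \<Rightarrow> 'a \<Rightarrow> real" where
  "sq_dist_cost \<xi> \<zeta> = (norm (\<xi> - \<zeta>))\<^sup>2"

definition ambiguity_set ::
    "real \<Rightarrow> real \<Rightarrow> real \<Rightarrow> 'a::euclidean_space set \<Rightarrow> 'a measure \<Rightarrow> 'a measure set" where
  "ambiguity_set \<sigma> \<epsilon> m \<Xi> P = {Q \<in> prob_measures \<Xi>.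
     entropic_wasserstein sq_dist_cost \<epsilon> (ref_coupling \<sigma> \<Xi> P) \<Xi> P Q \<le> ereal m}"

definition cvar_objective :: "real \<Rightarrow> ('a \<Rightarrow> real) \<Rightarrow> 'a measure \<Rightarrow> real \<Rightarrow> real" where
  "cvar_objective \<beta> f Q \<alpha> = \<alpha> + 1 / (1 - \<beta>) * (\<integral>\<xi>. max (f \<xi> - \<alpha>) 0 \<partial>Q)"

text \<open>The first function is the dual objective for \<open>l > 0\<close>; the second extends it to \<open>l = 0\<close> by its
  limit from the right.\<close>

definition dual_objective_pos ::
    "real \<Rightarrow> real \<Rightarrow> real \<Rightarrow> real \<Rightarrow> 'a::euclidean_space set \<Rightarrow> ('a \<Rightarrow> real) \<Rightarrow> 'a measure
      \<Rightarrow> real \<Rightarrow> real \<Rightarrow> real" where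
  "dual_objective_pos \<beta> m \<epsilon> \<sigma> \<Xi> f P l \<alpha> =
     \<alpha> + l * m / (1 - \<beta>)
       + l * \<epsilon> / (1 - \<beta>) *
           (\<integral>\<xi>. ln (\<integral>\<zeta>. exp ((max (f \<zeta> - \<alpha>) 0 - l * sq_dist_cost \<xi> \<zeta>) / (l * \<epsilon>))
                     \<partial>gauss_kernel \<sigma> \<Xi> \<xi>) \<partial>P)"

definition dual_objective ::
    "real \<Rightarrow> real \<Rightarrow> real \<Rightarrow> real \<Rightarrow> 'a::euclidean_space set \<Rightarrow> ('a \<Rightarrow> real) \<Rightarrow> 'a measure
      \<Rightarrow> real \<Rightarrow> real \<Rightarrow> real" where
  "dual_objective \<beta> m \<epsilon> \<sigma> \<Xi> f P l \<alpha> =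
     (if l = 0 then Lim (at_right 0) (\<lambda>l'. dual_objective_pos \<beta> m \<epsilon> \<sigma> \<Xi> f P l' \<alpha>)
      else dual_objective_pos \<beta> m \<epsilon> \<sigma> \<Xi> f P l \<alpha>)"

lemma finite_measure_lborel_restrict:
  fixes \<Xi> :: "'a::euclidean_space set"
  assumes "compact \<Xi>"
  shows "finite_measure (restrict_space lborel \<Xi>)"
  using emeasure_compact_finite[OF assms] assms
  by (intro finite_measureI)
    (simp add: space_restrict_space emeasure_restrict_space borel_compact)

lemma gauss_kernel_in_prob_measures:
  fixes \<Xi> :: "'a::euclidean_space set"
  assumes "compact \<Xi>" "emeasure lborel \<Xi> > 0"
  shows "gauss_kernel \<sigma> \<Xi> \<xi> \<in> prob_measures \<Xi>"
proof -
  let ?L = "restrict_space lborel \<Xi>"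
  let ?g = "\<lambda>\<zeta>. exp (- ((norm (\<xi> - \<zeta>))\<^sup>2 / (2 * \<sigma>\<^sup>2)))"
  have X: "\<Xi> \<in> sets borel" using assms(1) by (simp add: borel_compact)
  have sp: "space ?L = \<Xi>" by (simp add: space_restrict_space)
  have em: "emeasure ?L \<Xi> = emeasure lborel \<Xi>"
    using X by (simp add: emeasure_restrict_space)
  have meas [measurable]: "?g \<in> borel_measurable ?L"
    by (intro measurable_restrict_space1) measurable
  have int: "integrable ?L ?g"
    by (rule finite_measure.integrable_const_bound[OF finite_measure_lborel_restrict[OF assms(1)], of _ 1])
      auto
  have pos: "integral\<^sup>L ?L ?g > 0"
  proof -
    have "integral\<^sup>L ?L ?g \<noteq> 0"
    proof
      assume "integral\<^sup>L ?L ?g = 0"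
      then have "AE x in ?L. ?g x = 0"
        using integral_nonneg_eq_0_iff_AE[OF int] by simp
      then have "AE x in ?L. x \<notin> \<Xi>" by (rule AE_mp) simp
      then have "emeasure ?L \<Xi> = 0"
        by (subst (asm) AE_iff_measurable[of \<Xi>]) (auto simp: sp X sets_restrict_space)
      then show False using assms(2) em by simp
    qed
    moreover have "integral\<^sup>L ?L ?g \<ge> 0" by simp
    ultimately show ?thesis by linarith
  qed
  have "(\<integral>\<^sup>+\<zeta>. ennreal (gauss_norm_const \<sigma> \<Xi> \<xi> * ?g \<zeta>) \<partial>?L)
      = ennreal (\<integral>\<zeta>. gauss_norm_const \<sigma> \<Xi> \<xi> * ?g \<zeta> \<partial>?L)"
    by (rule nn_integral_eq_integral)
      (use int pos in \<open>auto simp: gauss_norm_const_def\<close>)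
  also have "\<dots> = 1" using pos by (simp add: gauss_norm_const_def)
  finally have one: "(\<integral>\<^sup>+\<zeta>. ennreal (gauss_norm_const \<sigma> \<Xi> \<xi> * ?g \<zeta>) \<partial>?L) = 1" .
  have "emeasure (gauss_kernel \<sigma> \<Xi> \<xi>) (space (gauss_kernel \<sigma> \<Xi> \<xi>))
      = (\<integral>\<^sup>+\<zeta>. ennreal (gauss_norm_const \<sigma> \<Xi> \<xi> * ?g \<zeta>) * indicator (space ?L) \<zeta> \<partial>?L)"
    unfolding gauss_kernel_def space_density by (rule emeasure_density) auto
  also have "\<dots> = 1"
    by (subst one[symmetric], rule nn_integral_cong) simp
  finally have "prob_space (gauss_kernel \<sigma> \<Xi> \<xi>)" by (rule prob_spaceI)
  then show ?thesis
    by (simp add: prob_measures_def gauss_kernel_def sets_restrict_space)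
qed

lemma gauss_kernel_measurable:
  fixes \<Xi> :: "'a::euclidean_space set"
  assumes "compact \<Xi>" "emeasure lborel \<Xi> > 0"
  shows "gauss_kernel \<sigma> \<Xi> \<in> borel_of \<Xi> \<rightarrow>\<^sub>M subprob_algebra (borel_of \<Xi>)"
proof (rule measurable_subprob_algebra)
  fix \<xi>
  show "subprob_space (gauss_kernel \<sigma> \<Xi> \<xi>)" "sets (gauss_kernel \<sigma> \<Xi> \<xi>) = sets (borel_of \<Xi>)"
    using gauss_kernel_in_prob_measures[OF assms, of \<sigma> \<xi>]
    by (auto simp: prob_measures_def prob_space_imp_subprob_space)
next
  let ?L = "restrict_space lborel \<Xi>"
  interpret L: finite_measure ?L by (rule finite_measure_lborel_restrict[OF assms(1)])
  have idL: "(\<lambda>x. x) \<in> ?L \<rightarrow>\<^sub>M borel" by (intro measurable_restrict_space1) simp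
  have idB: "(\<lambda>x. x) \<in> borel_of \<Xi> \<rightarrow>\<^sub>M borel" by (intro measurable_restrict_space1) simp
  have f1 [measurable]: "(\<lambda>p. fst p) \<in> borel_of \<Xi> \<Otimes>\<^sub>M ?L \<rightarrow>\<^sub>M borel"
    by (rule measurable_compose[OF measurable_fst idB])
  have f2 [measurable]: "(\<lambda>p. snd p) \<in> borel_of \<Xi> \<Otimes>\<^sub>M ?L \<rightarrow>\<^sub>M borel"
    by (rule measurable_compose[OF measurable_snd idL])
  have g [measurable]: "(\<lambda>p. exp (- ((norm (fst p - snd p))\<^sup>2 / (2 * \<sigma>\<^sup>2))))
      \<in> borel_measurable (borel_of \<Xi> \<Otimes>\<^sub>M ?L)"
    by measurable
  have "(\<lambda>\<xi>. \<integral>\<zeta>. exp (- ((norm (\<xi> - \<zeta>))\<^sup>2 / (2 * \<sigma>\<^sup>2))) \<partial>?L) \<in> borel_measurable (borel_of \<Xi>)"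
    by (rule L.borel_measurable_lebesgue_integral) (use g in \<open>simp add: case_prod_beta\<close>)
  then have c: "gauss_norm_const \<sigma> \<Xi> \<in> borel_measurable (borel_of \<Xi>)"
    unfolding gauss_norm_const_def by measurable
  have c' [measurable]: "(\<lambda>p. gauss_norm_const \<sigma> \<Xi> (fst p)) \<in> borel_measurable (borel_of \<Xi> \<Otimes>\<^sub>M ?L)"
    by (rule measurable_compose[OF measurable_fst c])
  fix A assume A: "A \<in> sets (borel_of \<Xi>)"
  then have A': "A \<in> sets ?L" by (simp add: sets_restrict_space)
  have i [measurable]: "(\<lambda>p. indicator A (snd p) :: ennreal) \<in> borel_measurable (borel_of \<Xi> \<Otimes>\<^sub>M ?L)"
    by (rule measurable_compose[OF measurable_snd]) (use A' in simp)
  have "(\<lambda>\<xi>. \<integral>\<^sup>+\<zeta>. ennreal (gauss_norm_const \<sigma> \<Xi> \<xi> * exp (- ((norm (\<xi> - \<zeta>))\<^sup>2 / (2 * \<sigma>\<^sup>2))))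
      * indicator A \<zeta> \<partial>?L) \<in> borel_measurable (borel_of \<Xi>)"
    by (rule L.borel_measurable_nn_integral) (unfold case_prod_beta, measurable)
  moreover have "(\<lambda>\<zeta>. ennreal (gauss_norm_const \<sigma> \<Xi> \<xi> * exp (- ((norm (\<xi> - \<zeta>))\<^sup>2 / (2 * \<sigma>\<^sup>2)))))
      \<in> borel_measurable ?L" for \<xi>
    by (intro measurable_restrict_space1) measurable
  ultimately show "(\<lambda>\<xi>. emeasure (gauss_kernel \<sigma> \<Xi> \<xi>) A) \<in> borel_measurable (borel_of \<Xi>)"
    unfolding gauss_kernel_def by (simp add: emeasure_density A')
qed

lemma Pair_measurable_borel_of:
  fixes X Y :: "'a::second_countable_topology set"
  shows "(\<lambda>(x, y). (x, y)) \<in> borel_of X \<Otimes>\<^sub>M borel_of Y \<rightarrow>\<^sub>M borel_of (X \<times> Y)"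
proof (rule measurable_restrict_space2)
  have 1: "(\<lambda>x. x) \<in> borel_of Z \<rightarrow>\<^sub>M borel" for Z :: "'a set"
    by (intro measurable_restrict_space1) simp
  have "(\<lambda>p. (fst p, snd p)) \<in> borel_of X \<Otimes>\<^sub>M borel_of Y \<rightarrow>\<^sub>M (borel \<Otimes>\<^sub>M borel)"
    by (intro measurable_Pair measurable_compose[OF measurable_fst 1]
        measurable_compose[OF measurable_snd 1])
  then show "(\<lambda>(x, y). (x, y)) \<in> borel_of X \<Otimes>\<^sub>M borel_of Y \<rightarrow>\<^sub>M borel"
    by (simp add: borel_prod case_prod_beta)
qed (auto simp: space_pair_measure space_restrict_space)

lemma ref_kernel_measurable:
  fixes \<Xi> :: "'a::euclidean_space set"
  assumes "compact \<Xi>" "emeasure lborel \<Xi> > 0"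
  shows "(\<lambda>\<xi>. distr (gauss_kernel \<sigma> \<Xi> \<xi>) (borel_of (\<Xi> \<times> \<Xi>)) (\<lambda>\<zeta>. (\<xi>, \<zeta>)))
    \<in> borel_of \<Xi> \<rightarrow>\<^sub>M subprob_algebra (borel_of (\<Xi> \<times> \<Xi>))"
  by (rule measurable_distr2[OF _ gauss_kernel_measurable[OF assms]])
    (rule Pair_measurable_borel_of)

lemma Pair_measurable_gauss_kernel:
  fixes \<Xi> :: "'a::euclidean_space set"
  assumes "compact \<Xi>" "emeasure lborel \<Xi> > 0" "\<xi> \<in> \<Xi>"
  shows "Pair \<xi> \<in> gauss_kernel \<sigma> \<Xi> \<xi> \<rightarrow>\<^sub>M borel_of (\<Xi> \<times> \<Xi>)"
proof -
  have "Pair \<xi> \<in> borel_of \<Xi> \<rightarrow>\<^sub>M borel_of \<Xi> \<Otimes>\<^sub>M borel_of \<Xi>"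
    by (rule measurable_Pair1') (simp add: space_restrict_space assms(3))
  from measurable_compose[OF this Pair_measurable_borel_of]
  have "Pair \<xi> \<in> borel_of \<Xi> \<rightarrow>\<^sub>M borel_of (\<Xi> \<times> \<Xi>)" by simp
  moreover have "sets (gauss_kernel \<sigma> \<Xi> \<xi>) = sets (borel_of \<Xi>)"
    using gauss_kernel_in_prob_measures[OF assms(1,2)] by (simp add: prob_measures_def)
  ultimately show ?thesis by (simp cong: measurable_cong_sets)
qed

lemma ref_coupling_in_prob_measures:
  fixes \<Xi> :: "'a::euclidean_space set"
  assumes "compact \<Xi>" "emeasure lborel \<Xi> > 0" "P \<in> prob_measures \<Xi>"
  shows "ref_coupling \<sigma> \<Xi> P \<in> prob_measures (\<Xi> \<times> \<Xi>)"
proof -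
  interpret P: prob_space P using assms(3) by (simp add: prob_measures_def)
  have sP: "sets P = sets (borel_of \<Xi>)" using assms(3) by (simp add: prob_measures_def)
  have spP: "space P = \<Xi>" using sets_eq_imp_space_eq[OF sP] by (simp add: space_restrict_space)
  let ?K = "\<lambda>\<xi>. distr (gauss_kernel \<sigma> \<Xi> \<xi>) (borel_of (\<Xi> \<times> \<Xi>)) (\<lambda>\<zeta>. (\<xi>, \<zeta>))"
  have K: "?K \<in> P \<rightarrow>\<^sub>M subprob_algebra (borel_of (\<Xi> \<times> \<Xi>))"
    using ref_kernel_measurable[OF assms(1,2)] sP by (simp cong: measurable_cong_sets)
  have "prob_space (?K \<xi>)" if "\<xi> \<in> space P" for \<xi>
    using that gauss_kernel_in_prob_measures[OF assms(1,2), of \<sigma> \<xi>]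
    by (intro prob_space.prob_space_distr Pair_measurable_gauss_kernel assms)
      (auto simp: prob_measures_def spP)
  then have "prob_space (P \<bind> ?K)"
    by (intro P.prob_space_bind[OF _ K]) auto
  moreover have "sets (P \<bind> ?K) = sets (borel_of (\<Xi> \<times> \<Xi>))"
    by (rule sets_bind[OF _ P.not_empty]) simp
  ultimately show ?thesis by (simp add: ref_coupling_def prob_measures_def)
qed

lemma continuous_on_borel_of_measurable:
  fixes \<phi> :: "'a::topological_space \<Rightarrow> real"
  shows "continuous_on X \<phi> \<Longrightarrow> \<phi> \<in> borel_measurable (borel_of X)"
  by (rule borel_measurable_continuous_on_restrict)

lemma integral_ref_coupling:
  fixes \<Xi> :: "'a::euclidean_space set" and \<phi> :: "'a \<times> 'a \<Rightarrow> real"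
  assumes "compact \<Xi>" "emeasure lborel \<Xi> > 0" "P \<in> prob_measures \<Xi>"
    and "continuous_on (\<Xi> \<times> \<Xi>) \<phi>"
  shows "(\<integral>x. \<phi> x \<partial>ref_coupling \<sigma> \<Xi> P) = (\<integral>\<xi>. (\<integral>\<zeta>. \<phi> (\<xi>, \<zeta>) \<partial>gauss_kernel \<sigma> \<Xi> \<xi>) \<partial>P)"
proof -
  interpret P: prob_space P using assms(3) by (simp add: prob_measures_def)
  have sP: "sets P = sets (borel_of \<Xi>)" using assms(3) by (simp add: prob_measures_def)
  have spP: "space P = \<Xi>" using sets_eq_imp_space_eq[OF sP] by (simp add: space_restrict_space)
  let ?K = "\<lambda>\<xi>. distr (gauss_kernel \<sigma> \<Xi> \<xi>) (borel_of (\<Xi> \<times> \<Xi>)) (\<lambda>\<zeta>. (\<xi>, \<zeta>))"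
  have K: "?K \<in> P \<rightarrow>\<^sub>M subprob_algebra (borel_of (\<Xi> \<times> \<Xi>))"
    using ref_kernel_measurable[OF assms(1,2)] sP by (simp cong: measurable_cong_sets)
  have phi: "\<phi> \<in> borel_measurable (borel_of (\<Xi> \<times> \<Xi>))"
    by (rule continuous_on_borel_of_measurable[OF assms(4)])
  obtain B where B: "\<And>x. x \<in> \<Xi> \<times> \<Xi> \<Longrightarrow> \<bar>\<phi> x\<bar> \<le> B"
  proof -
    have "bounded (\<phi> ` (\<Xi> \<times> \<Xi>))"
      by (intro compact_imp_bounded compact_continuous_image assms compact_Times)
    then show ?thesis using that unfolding bounded_iff by fastforce
  qed
  have "(\<integral>x. \<phi> x \<partial>(P \<bind> ?K)) = (\<integral>\<xi>. (\<integral>x. \<phi> x \<partial>?K \<xi>) \<partial>P)"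
  proof (rule integral_bind[OF phi _ K, where B=B and B'=1])
    show "finite_measure P" by unfold_locales
    show "\<bar>\<phi> x\<bar> \<le> B" if "x \<in> space (borel_of (\<Xi> \<times> \<Xi>))" for x
      using that by (intro B) (simp add: space_restrict_space)
    show "AE \<xi> in P. emeasure (?K \<xi>) (space (?K \<xi>)) \<le> ennreal 1"
    proof (intro AE_I2)
      fix \<xi> assume "\<xi> \<in> space P"
      then have "subprob_space (?K \<xi>)" using measurable_space[OF K] by (simp add: space_subprob_algebra)
      then show "emeasure (?K \<xi>) (space (?K \<xi>)) \<le> ennreal 1"
        by (simp add: subprob_space.emeasure_space_le_1 del: space_distr)
    qed
  qed
  also have "\<dots> = (\<integral>\<xi>. (\<integral>\<zeta>. \<phi> (\<xi>, \<zeta>) \<partial>gauss_kernel \<sigma> \<Xi> \<xi>) \<partial>P)"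
    by (intro Bochner_Integration.integral_cong refl integral_distr phi Pair_measurable_gauss_kernel assms)
      (simp add: spP)
  finally show ?thesis by (simp add: ref_coupling_def)
qed

lemma prob_measures_eqI:
  fixes X :: "'a::metric_space set"
  assumes M: "M \<in> prob_measures X" and N: "N \<in> prob_measures X"
    and eq: "\<And>\<phi> :: 'a \<Rightarrow> real. continuous_on X \<phi> \<Longrightarrow> bounded (\<phi> ` X) \<Longrightarrow>
      (\<integral>x. \<phi> x \<partial>M) = (\<integral>x. \<phi> x \<partial>N)"
  shows "M = N"
proof -
  define E where "E = {X \<inter> C | C. closed C}"
  have lim: "(\<lambda>n. \<integral>x. max 0 (1 - real n * infdist x C) \<partial>L) \<longlonglongrightarrow> measure L (X \<inter> C)"
    if L: "L \<in> prob_measures X" and C: "closed C" "C \<noteq> {}" for L C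
  proof -
    interpret L: prob_space L using L by (simp add: prob_measures_def)
    have sL: "sets L = sets (borel_of X)" using L by (simp add: prob_measures_def)
    have spL: "space L = X" using sets_eq_imp_space_eq[OF sL] by (simp add: space_restrict_space)
    have XC: "X \<inter> C \<in> sets L" using C(1) by (auto simp: sL sets_restrict_space)
    have "(\<lambda>n. \<integral>x. max 0 (1 - real n * infdist x C) \<partial>L) \<longlonglongrightarrow> (\<integral>x. indicator (X \<inter> C) x \<partial>L)"
    proof (rule integral_dominated_convergence[where w="\<lambda>_. 1"])
      show "(\<lambda>x. max 0 (1 - real n * infdist x C)) \<in> borel_measurable L" for n
        unfolding measurable_cong_sets[OF sL refl]
        by (intro continuous_on_borel_of_measurable continuous_intros)
      show "AE x in L. (\<lambda>n. max 0 (1 - real n * infdist x C)) \<longlonglongrightarrow> indicator (X \<inter> C) x"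
      proof (rule AE_I2)
        fix x assume "x \<in> space L"
        then have x: "x \<in> X" by (simp add: spL)
        show "(\<lambda>n. max 0 (1 - real n * infdist x C)) \<longlonglongrightarrow> indicator (X \<inter> C) x"
        proof (cases "x \<in> C")
          case True
          then show ?thesis using x by simp
        next
          case False
          then have d: "infdist x C > 0" using C by (simp add: infdist_pos_not_in_closed)
          obtain n0 where "1 / infdist x C < real n0" using reals_Archimedean2 by blast
          then have n0: "1 < real n0 * infdist x C" using d by (simp add: field_simps)
          have "max 0 (1 - real n * infdist x C) = 0" if "n \<ge> n0" for n
          proof -
            have "real n0 * infdist x C \<le> real n * infdist x C" using that d by simp
            then show ?thesis using n0 by simp
          qed
          then have "eventually (\<lambda>n. max 0 (1 - real n * infdist x C) = 0) sequentially"
            unfolding eventually_sequentially by blast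
          then show ?thesis using False by (simp add: tendsto_eventually)
        qed
      qed
      show "AE x in L. norm (max 0 (1 - real n * infdist x C)) \<le> 1" for n
        by (simp add: infdist_nonneg)
    qed (use XC in auto)
    then show ?thesis using XC by simp
  qed
  interpret M: prob_space M using M by (simp add: prob_measures_def)
  interpret N: prob_space N using N by (simp add: prob_measures_def)
  have sM: "sets M = sets (borel_of X)" and sN: "sets N = sets (borel_of X)"
    using M N by (simp_all add: prob_measures_def)
  have spM: "space M = X" using sets_eq_imp_space_eq[OF sM] by (simp add: space_restrict_space)
  have "sets (borel_of X) = sigma_sets X E"
  proof -
    have "sets (borel_of X) = {id -` A \<inter> X | A. A \<in> sigma_sets UNIV (Collect closed)}"
      by (auto simp: sets_restrict_space borel_eq_closed)
    also have "\<dots> = sigma_sets X {id -` A \<inter> X | A. A \<in> Collect closed}"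
      by (rule sigma_sets_vimage_commute) simp
    also have "{id -` A \<inter> X | A. A \<in> Collect closed} = E" by (auto simp: E_def)
    finally show ?thesis .
  qed
  then have gen: "sets M = sigma_sets X E" "sets N = sigma_sets X E" by (simp_all add: sM sN)
  show ?thesis
  proof (rule measure_eqI_generator_eq[where E=E and \<Omega>=X and A="\<lambda>_. X"])
    show "Int_stable E"
    proof (rule Int_stableI)
      fix a b assume "a \<in> E" "b \<in> E"
      then obtain C D where CD: "closed C" "closed D" "a = X \<inter> C" "b = X \<inter> D" by (auto simp: E_def)
      then have "a \<inter> b = X \<inter> (C \<inter> D)" "closed (C \<inter> D)" by auto
      then show "a \<inter> b \<in> E" unfolding E_def by blast
    qed
    show "E \<subseteq> Pow X" by (auto simp: E_def)
    show "emeasure M A = emeasure N A" if AinE: "A \<in> E" for A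
    proof -
      obtain C where C: "closed C" "A = X \<inter> C" using AinE by (auto simp: E_def)
      show ?thesis
      proof (cases "C = {}")
        case False
        have "(\<integral>x. max 0 (1 - real n * infdist x C) \<partial>M) = (\<integral>x. max 0 (1 - real n * infdist x C) \<partial>N)" for n
        proof (rule eq)
          show "continuous_on X (\<lambda>x. max 0 (1 - real n * infdist x C))"
            by (intro continuous_intros)
          show "bounded ((\<lambda>x. max 0 (1 - real n * infdist x C)) ` X)"
            by (rule boundedI[of _ 1]) (auto simp: infdist_nonneg)
        qed
        then have "measure M A = measure N A"
          using LIMSEQ_unique[OF lim[OF M C(1) False]] lim[OF N C(1) False] C(2) by simp
        then show ?thesis by (simp add: M.emeasure_eq_measure N.emeasure_eq_measure)
      qed (simp add: C)
    qed
    show "range (\<lambda>_. X) \<subseteq> E" unfolding E_def using closed_UNIV by blast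
  qed (use gen M.emeasure_finite in auto)
qed

lemma ref_coupling_unique:
  fixes \<Xi> :: "'a::euclidean_space set"
  assumes "compact \<Xi>" "emeasure lborel \<Xi> > 0" "P \<in> prob_measures \<Xi>"
    and "M \<in> prob_measures (\<Xi> \<times> \<Xi>)"
    and "\<And>\<phi> :: 'a \<times> 'a \<Rightarrow> real. continuous_on (\<Xi> \<times> \<Xi>) \<phi> \<Longrightarrow>
      (\<integral>x. \<phi> x \<partial>M) = (\<integral>\<xi>. (\<integral>\<zeta>. \<phi> (\<xi>, \<zeta>) \<partial>gauss_kernel \<sigma> \<Xi> \<xi>) \<partial>P)"
  shows "M = ref_coupling \<sigma> \<Xi> P"
  using assms(4) ref_coupling_in_prob_measures[OF assms(1-3)]
  by (rule prob_measures_eqI) (simp add: assms(5) integral_ref_coupling[OF assms(1-3)])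

end

theory Submission
  imports Defs
begin

text \<open>
  Write \<open>R\<close> for the reference coupling, \<open>c\<close> for the squared distance,
  \<open>g\<^sub>\<alpha> = [f - \<alpha>]\<^sub>+\<close> and \<open>J \<pi> = \<integral>c d\<pi> + \<epsilon> H(\<pi>)\<close>. After multiplication by \<open>1 - \<beta>\<close> the left-hand side
  maximizes \<open>min\<^sub>\<alpha> p(\<pi>, \<alpha>)\<close> with \<open>p(\<pi>, \<alpha>) = (1 - \<beta>) \<alpha> + \<integral>g\<^sub>\<alpha> d\<pi>\<close>, over plans \<open>\<pi>\<close> with first marginal \<open>P\<close>
  and \<open>J \<pi> \<le> m\<close>, and the right-hand side minimizes
  \<open>D(\<lambda>, \<alpha>) = (1 - \<beta>) \<alpha> + \<lambda> m + \<lambda> \<epsilon> \<Lambda>(h)\<close> at the tilt \<open>h = (g\<^sub>\<alpha> - \<lambda> c) / (\<lambda> \<epsilon>)\<close>, where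
  \<open>\<Lambda>(h) = \<integral> log (\<integral> exp h(\<xi>, \<zeta>) d\<nu>\<^sub>\<xi>(\<zeta>)) dP(\<xi>)\<close>.

  Among plans with first marginal \<open>P\<close>, entropy and \<open>\<Lambda>\<close> are conjugate: \<open>H(\<pi>) \<ge> \<integral>h d\<pi> - \<Lambda>(h)\<close>
  (\<open>donsker_varadhan\<close>), with equality at the Gibbs plan of \<open>h\<close>, the density of which is \<open>exp h\<close>
  normalized fibre by fibre (\<open>rel_entropy_gibbs\<close>). The inequality at the tilt is weak duality.

  The converse constructs an almost optimal plan from an almost optimal dual point. For
  \<open>\<eta> > 0\<close> let \<open>(\<lambda>*, \<alpha>*)\<close> minimize \<open>D\<close> over \<open>\<lambda> \<ge> \<eta>\<close>, and let \<open>\<pi>*\<close> be the Gibbs plan of its tilt. Because \<open>\<Lambda>\<close> is smooth (\<open>log_mgf_smooth\<close>), \<open>D\<close> lies below the Lagrangian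
  \<open>p(\<pi>*, \<alpha>) + \<lambda> (m - J \<pi>*)\<close> up to a quadratic error, and touches it at \<open>(\<lambda>*, \<alpha>*)\<close>. The Lagrangian is
  convex in \<open>\<alpha>\<close> and affine in \<open>\<lambda>\<close>, so it is itself minimal there (\<open>first_order_optimality\<close>). Increasing
  \<open>\<lambda>\<close> gives \<open>J \<pi>* \<le> m\<close>, that is, feasibility; moving \<open>\<lambda>\<close> to \<open>\<eta>\<close> and \<open>\<alpha>\<close> anywhere gives
  \<open>D(\<lambda>*, \<alpha>*) \<le> p(\<pi>*, \<alpha>) + \<eta> m\<close> for all \<open>\<alpha>\<close> (\<open>near_optimal_plan\<close>). Then let \<open>\<eta>\<close> tend to \<open>0\<close>. The
  cut-off \<open>\<eta>\<close> guarantees a minimizer even if the dual infimum is only approached as \<open>\<lambda>\<close> tends to \<open>0\<close>,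
  at the price of the term \<open>\<eta> m\<close>.

  This minimizer exists if \<open>m\<close> exceeds the least value \<open>- \<epsilon> \<Lambda>(- c / \<epsilon>)\<close> of \<open>J\<close>. If \<open>m\<close> is smaller, no plan is
  feasible and \<open>D\<close> is unbounded below as \<open>\<lambda>\<close> grows. If \<open>m\<close> equals that value, the Gibbs plan of
  \<open>- c / \<epsilon>\<close> is feasible and \<open>D(\<lambda>, \<alpha>)\<close> tends to its value \<open>p\<close> as \<open>\<lambda>\<close> grows. Finally, the dual value at
  \<open>\<lambda> = 0\<close> is a limit of values at \<open>\<lambda> > 0\<close>, which exists by convexity of \<open>\<Lambda>\<close>
  (\<open>scaled_log_mgf_converges\<close>), so it does not change the infimum.
\<close>

section \<open>Lower bounds and formulas for relative entropy\<close>

lemma ext_integral_eq_integral: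
  assumes "integrable M g"
  shows "ext_integral M g = ereal (integral\<^sup>L M g)"
proof -
  have "(\<integral>\<^sup>+x. ennreal (g x) \<partial>M) < \<top>" "(\<integral>\<^sup>+x. ennreal (- g x) \<partial>M) < \<top>"
    using assms by (auto simp: real_integrable_def less_top[symmetric])
  then obtain a b where ab: "a \<ge> 0" "(\<integral>\<^sup>+x. ennreal (g x) \<partial>M) = ennreal a"
      "b \<ge> 0" "(\<integral>\<^sup>+x. ennreal (- g x) \<partial>M) = ennreal b"
    by (metis ennreal_cases less_irrefl)
  then show ?thesis
    unfolding ext_integral_def real_lebesgue_integral_def[OF assms] by simp
qed

text \<open>
  Jensen's inequality \<open>\<integral>(k - u) \<le> log (\<integral> exp (k - u)) \<le> 0\<close>, here from \<open>v \<le> exp v - 1\<close>. The work is in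
  integrability: the bound on \<open>exp (k - u)\<close> controls the negative part of \<open>u\<close>, so the extended integral
  of \<open>u\<close> can only be infinite upwards, where the claim is trivial.
\<close>

lemma integral_le_ext_integral:
  assumes M: "prob_space M"
    and k: "integrable M k" and u [measurable]: "u \<in> borel_measurable M"
    and exp_le: "(\<integral>\<^sup>+x. ennreal (exp (k x - u x)) \<partial>M) \<le> 1"
  shows "ereal (integral\<^sup>L M k) \<le> ext_integral M u"
proof (cases "(\<integral>\<^sup>+x. ennreal (u x) \<partial>M) = \<top>")
  case True
  then show ?thesis by (simp add: ext_integral_def)
next
  case False
  interpret prob_space M by (rule M)
  have k_meas [measurable]: "k \<in> borel_measurable M" using k by auto
  have int_exp: "integrable M (\<lambda>x. exp (k x - u x))"
    using exp_le by (intro integrableI_nonneg) (auto simp: order_le_less_trans)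
  have bound: "integrable M (\<lambda>x. exp (k x - u x) + \<bar>k x\<bar>)"
    using int_exp k by auto
  have "(\<integral>\<^sup>+x. ennreal (- u x) \<partial>M) \<le> (\<integral>\<^sup>+x. ennreal (exp (k x - u x) + \<bar>k x\<bar>) \<partial>M)"
  proof (intro nn_integral_mono ennreal_leI)
    fix x
    show "- u x \<le> exp (k x - u x) + \<bar>k x\<bar>" using exp_ge_add_one_self[of "k x - u x"] by linarith
  qed
  also have "\<dots> < \<top>"
    using bound by (subst nn_integral_eq_integral) (auto intro!: AE_I2 add_nonneg_nonneg)
  finally have int_u: "integrable M u"
    using False by (auto simp: real_integrable_def)
  have "(\<integral>x. k x - u x \<partial>M) \<le> (\<integral>x. exp (k x - u x) - 1 \<partial>M)"
  proof (rule integral_mono)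
    show "k x - u x \<le> exp (k x - u x) - 1" for x using exp_ge_add_one_self[of "k x - u x"] by linarith
  qed (use k int_u int_exp in auto)
  also have "\<dots> = (\<integral>x. exp (k x - u x) \<partial>M) - 1" using int_exp by (simp add: prob_space)
  also have "\<dots> \<le> 0"
  proof -
    have "ennreal (\<integral>x. exp (k x - u x) \<partial>M) \<le> 1"
      using exp_le int_exp by (subst nn_integral_eq_integral[symmetric]) auto
    then show ?thesis by simp
  qed
  finally have "integral\<^sup>L M k \<le> integral\<^sup>L M u" using k int_u by simp
  then show ?thesis by (simp add: ext_integral_eq_integral[OF int_u])
qed

lemma rel_entropy_density:
  fixes D :: "'a \<Rightarrow> real"
  assumes "sigma_finite_measure R" and D [measurable]: "D \<in> borel_measurable R"
    and D0: "\<And>x. x \<in> space R \<Longrightarrow> D x > 0"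
    and int: "integrable (density R D) (\<lambda>x. ln (D x))"
  shows "rel_entropy R (density R D) = ereal (\<integral>x. ln (D x) \<partial>density R D)"
proof -
  interpret sigma_finite_measure R by fact
  have ac: "absolutely_continuous R (density R D)" by (rule absolutely_continuousI_density) simp
  have "AE x in R. ennreal (D x) = RN_deriv R (density R D) x"
    by (rule RN_deriv_unique) auto
  moreover have "AE x in R. D x > 0" using D0 by auto
  ultimately have "AE x in R. ln (enn2real (RN_deriv R (density R D) x)) = ln (D x)"
    by eventually_elim (metis enn2real_ennreal less_imp_le)
  then have *: "AE x in density R D. ln (enn2real (RN_deriv R (density R D) x)) = ln (D x)"
    by (rule absolutely_continuous_AE[OF sets_density ac])
  have "ext_integral (density R D) (\<lambda>x. ln (enn2real (RN_deriv R (density R D) x)))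
      = ext_integral (density R D) (\<lambda>x. ln (D x))"
    unfolding ext_integral_def
    by (intro arg_cong2[where f="(-)"] arg_cong[where f=enn2ereal] nn_integral_cong_AE)
      (use * in auto)
  then show ?thesis
    using ac by (simp add: rel_entropy_def ext_integral_eq_integral[OF int])
qed

text \<open>
  With \<open>\<phi> = exp k\<close>, a density of total mass at most \<open>1\<close>, this says that the relative entropy of \<open>\<pi>\<close> with
  respect to \<open>\<phi> R\<close> is nonnegative.
\<close>

lemma rel_entropy_lower_bound:
  assumes "sigma_finite_measure R" and \<pi>: "prob_space \<pi>" "sets \<pi> = sets R"
    and k: "integrable \<pi> k" and exp_le: "(\<integral>\<^sup>+x. ennreal (exp (k x)) \<partial>R) \<le> 1"
  shows "ereal (integral\<^sup>L \<pi> k) \<le> rel_entropy R \<pi>"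
proof (cases "absolutely_continuous R \<pi>")
  case False
  then show ?thesis by (simp add: rel_entropy_def)
next
  case True
  interpret sigma_finite_measure R by fact
  let ?D = "RN_deriv R \<pi>"
  have dens: "density R ?D = \<pi>" by (rule density_RN_deriv[OF True \<pi>(2)])
  have [measurable]: "k \<in> borel_measurable R"
    using borel_measurable_integrable[OF k] by (simp add: measurable_cong_sets[OF \<pi>(2) refl])
  have fin: "AE x in R. ?D x \<noteq> \<infinity>"
    using RN_deriv_finite[OF _ True \<pi>(2)] \<pi>(1) prob_space_imp_sigma_finite by blast
  have "(\<integral>\<^sup>+x. ennreal (exp (k x - ln (enn2real (?D x)))) \<partial>\<pi>)
      = (\<integral>\<^sup>+x. ?D x * ennreal (exp (k x - ln (enn2real (?D x)))) \<partial>R)"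
    by (subst dens[symmetric], subst nn_integral_density) auto
  also have "\<dots> \<le> (\<integral>\<^sup>+x. ennreal (exp (k x)) \<partial>R)"
  proof (rule nn_integral_mono_AE, use fin in eventually_elim)
    fix x assume "?D x \<noteq> \<infinity>"
    then obtain d where d: "d \<ge> 0" "?D x = ennreal d" by (cases "?D x") auto
    show "?D x * ennreal (exp (k x - ln (enn2real (?D x)))) \<le> ennreal (exp (k x))"
      using d by (cases "d = 0") (auto simp: exp_diff simp flip: ennreal_mult)
  qed
  also note exp_le
  finally have "ereal (integral\<^sup>L \<pi> k) \<le> ext_integral \<pi> (\<lambda>x. ln (enn2real (?D x)))"
    by (intro integral_le_ext_integral[OF \<pi>(1) k]) (auto simp: measurable_cong_sets[OF \<pi>(2) refl])
  then show ?thesis using True by (simp add: rel_entropy_def)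
qed

section \<open>Elementary inequalities for real numbers\<close>

text \<open>
  For negative \<open>u\<close>, use \<open>(1 + u + u\<^sup>2) (1 - u) = 1 - u\<^sup>3\<close> and \<open>exp (- u) \<ge> 1 - u\<close>.
\<close>

lemma exp_le_quadratic:
  fixes u :: real
  assumes "\<bar>u\<bar> \<le> 1"
  shows "exp u \<le> 1 + u + u\<^sup>2"
proof (cases "u \<ge> 0")
  case True
  then show ?thesis using exp_bound[of u] assms by simp
next
  case False
  have "0 \<le> - (u ^ 3)" using False by (simp add: power_less_zero_eq)
  then have "1 \<le> (1 + u + u\<^sup>2) * (1 - u)"
    by (simp add: algebra_simps power2_eq_square power3_eq_cube)
  also have "\<dots> \<le> (1 + u + u\<^sup>2) * exp (- u)"
    using exp_ge_add_one_self[of "- u"] assms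
    by (intro mult_left_mono) auto
  finally show ?thesis by (simp add: exp_minus field_simps)
qed

text \<open>
  Extracts a first-order optimality condition from a second-order estimate along a segment.
\<close>

lemma nonneg_of_quadratic_lower_bound:
  fixes A M s0 :: real
  assumes "s0 > 0" and ge: "\<And>s. 0 < s \<Longrightarrow> s \<le> s0 \<Longrightarrow> 0 \<le> s * A + s\<^sup>2 * M"
  shows "0 \<le> A"
proof (rule tendsto_lowerbound)
  show "((\<lambda>s. A + s * M) \<longlongrightarrow> A) (at_right 0)"
    by (rule tendsto_eq_intros refl | simp)+
  have "0 \<le> A + s * M" if "0 < s" "s < s0" for s
  proof -
    have "0 \<le> s * (A + s * M)" using ge[of s] that by (simp add: power2_eq_square algebra_simps)
    then show ?thesis using that by (simp add: zero_le_mult_iff)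
  qed
  then show "eventually (\<lambda>s. 0 \<le> A + s * M) (at_right 0)"
    using \<open>s0 > 0\<close> by (intro eventually_at_rightI[of 0 s0]) auto
qed simp

section \<open>Fibrewise moment generating functions and Gibbs plans\<close>

text \<open>
  A coupling that draws \<open>x\<close> from \<open>P\<close> and then \<open>y\<close> from \<open>K x\<close>. The argument uses \<open>R\<close> only through its
  iterated integrals, so \<open>R\<close> is a parameter characterized by them and not a fixed construction.
\<close>

locale kernel_coupling =
  fixes P :: "'a measure" and B :: "'b measure" and K :: "'a \<Rightarrow> 'b measure"
    and R :: "('a \<times> 'b) measure"
  assumes prob_space_P: "prob_space P"
    and kernel [measurable]: "K \<in> P \<rightarrow>\<^sub>M prob_algebra B"
    and sets_R [measurable_cong]: "sets R = sets (P \<Otimes>\<^sub>M B)"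
    and nn_integral_R: "\<And>g. g \<in> borel_measurable (P \<Otimes>\<^sub>M B) \<Longrightarrow>
      (\<integral>\<^sup>+z. g z \<partial>R) = (\<integral>\<^sup>+x. (\<integral>\<^sup>+y. g (x, y) \<partial>K x) \<partial>P)"
begin

sublocale P: prob_space P by (rule prob_space_P)

lemma kernel_subprob [measurable]: "K \<in> P \<rightarrow>\<^sub>M subprob_algebra B"
  using kernel by (rule measurable_prob_algebraD)

lemma prob_space_kernel: "x \<in> space P \<Longrightarrow> prob_space (K x)"
  using measurable_space[OF kernel] by (simp add: space_prob_algebra)

lemma sets_kernel: "x \<in> space P \<Longrightarrow> sets (K x) = sets B"
  using measurable_space[OF kernel] by (simp add: space_prob_algebra)

lemma space_kernel: "x \<in> space P \<Longrightarrow> space (K x) = space B"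
  using sets_kernel sets_eq_imp_space_eq by blast

lemma space_R: "space R = space P \<times> space B"
  using sets_eq_imp_space_eq[OF sets_R] by (simp add: space_pair_measure)

sublocale R: prob_space R
proof (rule prob_spaceI)
  have "emeasure R (space R) = (\<integral>\<^sup>+z. 1 \<partial>R)" by simp
  also have "\<dots> = (\<integral>\<^sup>+x. 1 \<partial>P)"
    by (subst nn_integral_R)
      (auto intro!: nn_integral_cong simp: prob_space.emeasure_space_1 prob_space_kernel
        simp del: nn_integral_const, simp add: prob_space.emeasure_space_1 prob_space_kernel)
  finally show "emeasure R (space R) = 1" by (simp add: P.emeasure_space_1)
qed

definition bounded_measurable :: "('a \<times> 'b \<Rightarrow> real) \<Rightarrow> bool" where
  "bounded_measurable h \<longleftrightarrow>
     h \<in> borel_measurable (P \<Otimes>\<^sub>M B) \<and> (\<exists>C. \<forall>z \<in> space P \<times> space B. \<bar>h z\<bar> \<le> C)"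

definition mgf :: "('a \<times> 'b \<Rightarrow> real) \<Rightarrow> 'a \<Rightarrow> real" where
  "mgf h x = (\<integral>y. exp (h (x, y)) \<partial>K x)"

definition log_mgf :: "('a \<times> 'b \<Rightarrow> real) \<Rightarrow> real" where
  "log_mgf h = (\<integral>x. ln (mgf h x) \<partial>P)"

definition gibbs_density :: "('a \<times> 'b \<Rightarrow> real) \<Rightarrow> 'a \<times> 'b \<Rightarrow> real" where
  "gibbs_density h z = exp (h z) / mgf h (fst z)"

definition gibbs :: "('a \<times> 'b \<Rightarrow> real) \<Rightarrow> ('a \<times> 'b) measure" where
  "gibbs h = density R (gibbs_density h)"

lemma bounded_measurableD [measurable_dest]:
  "bounded_measurable h \<Longrightarrow> h \<in> borel_measurable (P \<Otimes>\<^sub>M B)"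
  by (simp add: bounded_measurable_def)

lemma bounded_measurable_bound:
  assumes "bounded_measurable h"
  obtains C where "\<And>x y. x \<in> space P \<Longrightarrow> y \<in> space B \<Longrightarrow> \<bar>h (x, y)\<bar> \<le> C"
  using assms unfolding bounded_measurable_def by auto

lemma bounded_measurable_const [simp]: "bounded_measurable (\<lambda>z. c)"
  by (auto simp: bounded_measurable_def)

lemma bounded_measurable_add:
  assumes "bounded_measurable g" "bounded_measurable h"
  shows "bounded_measurable (\<lambda>z. g z + h z)"
proof -
  obtain C D where "\<forall>z \<in> space P \<times> space B. \<bar>g z\<bar> \<le> C" "\<forall>z \<in> space P \<times> space B. \<bar>h z\<bar> \<le> D"
    using assms by (auto simp: bounded_measurable_def)
  then have "\<forall>z \<in> space P \<times> space B. \<bar>g z + h z\<bar> \<le> C + D" by fastforce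
  then show ?thesis using assms by (auto simp: bounded_measurable_def)
qed

lemma bounded_measurable_cmult:
  assumes "bounded_measurable h"
  shows "bounded_measurable (\<lambda>z. c * h z)"
proof -
  obtain C where "\<forall>z \<in> space P \<times> space B. \<bar>h z\<bar> \<le> C"
    using assms by (auto simp: bounded_measurable_def)
  then have "\<forall>z \<in> space P \<times> space B. \<bar>c * h z\<bar> \<le> \<bar>c\<bar> * C"
    by (auto simp: abs_mult mult_left_mono)
  then show ?thesis using assms by (auto simp: bounded_measurable_def)
qed

lemma bounded_measurable_diff:
  assumes "bounded_measurable g" "bounded_measurable h"
  shows "bounded_measurable (\<lambda>z. g z - h z)"
  using bounded_measurable_add[OF assms(1) bounded_measurable_cmult[OF assms(2), of "-1"]] by simp

lemma bounded_measurable_divide: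
  "bounded_measurable h \<Longrightarrow> bounded_measurable (\<lambda>z. h z / c)"
  using bounded_measurable_cmult[of h "1 / c"] by simp

lemma section_measurable:
  assumes h: "bounded_measurable h" and x: "x \<in> space P"
  shows "(\<lambda>y. h (x, y)) \<in> borel_measurable (K x)"
  using measurable_compose[OF measurable_Pair1'[OF x] bounded_measurableD[OF h]]
  by (simp add: measurable_cong_sets[OF sets_kernel[OF x] refl])

lemma integrable_kernel_exp:
  assumes h: "bounded_measurable h" and x: "x \<in> space P"
  shows "integrable (K x) (\<lambda>y. exp (h (x, y)))"
proof -
  interpret prob_space "K x" by (rule prob_space_kernel[OF x])
  note [measurable] = section_measurable[OF h x]
  obtain C where C: "\<And>x y. x \<in> space P \<Longrightarrow> y \<in> space B \<Longrightarrow> \<bar>h (x, y)\<bar> \<le> C"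
    using bounded_measurable_bound[OF h] by blast
  show ?thesis
    by (rule integrable_const_bound[of _ "exp C"])
      (use C[OF x, THEN abs_le_D1] x in \<open>auto simp: space_kernel intro!: AE_I2\<close>)
qed

lemma ennreal_mgf:
  assumes h: "bounded_measurable h" and x: "x \<in> space P"
  shows "(\<integral>\<^sup>+y. ennreal (exp (h (x, y))) \<partial>K x) = ennreal (mgf h x)"
  unfolding mgf_def by (rule nn_integral_eq_integral) (use integrable_kernel_exp[OF assms] in auto)

lemma mgf_measurable [measurable]:
  assumes [measurable]: "bounded_measurable h"
  shows "mgf h \<in> borel_measurable P"
proof -
  have "mgf h x = enn2real (\<integral>\<^sup>+y. ennreal (exp (h (x, y))) \<partial>K x)" if "x \<in> space P" for x
    using ennreal_mgf[OF assms that] by (simp add: mgf_def)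
  moreover have "(\<lambda>x. \<integral>\<^sup>+y. ennreal (exp (h (x, y))) \<partial>K x) \<in> borel_measurable P"
    by (rule nn_integral_measurable_subprob_algebra2[OF _ kernel_subprob])
      (unfold case_prod_beta' prod.collapse, measurable)
  ultimately show ?thesis by (subst measurable_cong) auto
qed

lemma mgf_mono_shift:
  assumes g: "bounded_measurable g" and h: "bounded_measurable h" and x: "x \<in> space P"
    and le: "\<And>y. y \<in> space B \<Longrightarrow> g (x, y) \<le> h (x, y) + d"
  shows "mgf g x \<le> exp d * mgf h x"
proof -
  have "mgf g x \<le> (\<integral>y. exp d * exp (h (x, y)) \<partial>K x)"
    unfolding mgf_def using le x
    by (intro integral_mono integrable_kernel_exp[OF g x] integrable_mult_right
        integrable_kernel_exp[OF h x]) (auto simp: space_kernel algebra_simps simp flip: exp_add)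
  then show ?thesis by (simp add: mgf_def)
qed

lemma mgf_const: "x \<in> space P \<Longrightarrow> mgf (\<lambda>z. c) x = exp c"
  using prob_space.prob_space[OF prob_space_kernel] by (simp add: mgf_def)

lemma mgf_bounds:
  assumes h: "bounded_measurable h" and x: "x \<in> space P"
    and C: "\<And>y. y \<in> space B \<Longrightarrow> \<bar>h (x, y)\<bar> \<le> C"
  shows "exp (- C) \<le> mgf h x" "mgf h x \<le> exp C"
proof -
  have "mgf (\<lambda>z. 0) x \<le> exp C * mgf h x"
    by (rule mgf_mono_shift[OF _ h x]) (use C in \<open>auto simp: abs_le_iff\<close>, smt (verit) C)
  then show "exp (- C) \<le> mgf h x" by (simp add: mgf_const[OF x] exp_minus field_simps)
  have "mgf h x \<le> exp C * mgf (\<lambda>z. 0) x"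
    by (rule mgf_mono_shift[OF h _ x]) (use C in \<open>auto simp: abs_le_iff\<close>)
  then show "mgf h x \<le> exp C" by (simp add: mgf_const[OF x])
qed

lemma mgf_pos:
  assumes h: "bounded_measurable h" and x: "x \<in> space P"
  shows "mgf h x > 0"
  using mgf_bounds(1)[OF assms] bounded_measurable_bound[OF h] x
  by (metis exp_gt_zero less_le_trans)

lemma bounded_measurable_ln_mgf:
  assumes h: "bounded_measurable h"
  shows "bounded_measurable (\<lambda>z. ln (mgf h (fst z)))"
proof -
  obtain C where C: "\<And>x y. x \<in> space P \<Longrightarrow> y \<in> space B \<Longrightarrow> \<bar>h (x, y)\<bar> \<le> C"
    using bounded_measurable_bound[OF h] by blast
  have "\<bar>ln (mgf h x)\<bar> \<le> C" if x: "x \<in> space P" for x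
    using mgf_bounds[OF h x C[OF x]] mgf_pos[OF h x]
    by (metis abs_le_iff exp_gt_zero ln_exp ln_le_cancel_iff minus_le_iff)
  then show ?thesis using h by (auto simp: bounded_measurable_def)
qed

lemma integrable_ln_mgf:
  assumes h: "bounded_measurable h"
  shows "integrable P (\<lambda>x. ln (mgf h x))"
proof -
  obtain C where C: "\<And>x y. x \<in> space P \<Longrightarrow> y \<in> space B \<Longrightarrow> \<bar>ln (mgf h x)\<bar> \<le> C"
    using bounded_measurable_bound[OF bounded_measurable_ln_mgf[OF h]] by fastforce
  have ne: "space B \<noteq> {}"
    using prob_space.not_empty[OF prob_space_kernel] P.not_empty space_kernel by blast
  show ?thesis
    by (rule P.integrable_const_bound[of _ C]) (use C ne h in auto)
qed

lemma integrable_bounded_measurable: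
  assumes h: "bounded_measurable h" and \<pi>: "prob_space \<pi>" "sets \<pi> = sets R"
  shows "integrable \<pi> h"
proof -
  interpret \<pi>: prob_space \<pi> by fact
  have sp: "space \<pi> = space P \<times> space B" using sets_eq_imp_space_eq[OF \<pi>(2)] space_R by simp
  obtain C where "\<forall>z \<in> space P \<times> space B. \<bar>h z\<bar> \<le> C"
    using h by (auto simp: bounded_measurable_def)
  then show ?thesis
    by (intro \<pi>.integrable_const_bound[of _ C])
     (use h sp in \<open>auto simp: measurable_cong_sets[OF \<pi>(2) refl] measurable_cong_sets[OF sets_R refl] bounded_measurable_def\<close>)
qed

text \<open>
  With \<open>d = 0\<close> this is monotonicity, and applied in both directions it says that \<open>log_mgf\<close> is
  \<open>1\<close>-Lipschitz in the supremum norm, which gives the continuity of the dual function.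
\<close>

lemma log_mgf_mono_shift:
  assumes g: "bounded_measurable g" and h: "bounded_measurable h"
    and le: "\<And>x y. x \<in> space P \<Longrightarrow> y \<in> space B \<Longrightarrow> g (x, y) \<le> h (x, y) + d"
  shows "log_mgf g \<le> log_mgf h + d"
proof -
  have "log_mgf g \<le> (\<integral>x. ln (mgf h x) + d \<partial>P)"
    unfolding log_mgf_def
  proof (intro integral_mono)
    fix x assume x: "x \<in> space P"
    have "ln (mgf g x) \<le> ln (exp d * mgf h x)"
      using mgf_mono_shift[OF g h x le[OF x]] mgf_pos[OF g x] by simp
    then show "ln (mgf g x) \<le> ln (mgf h x) + d"
      using mgf_pos[OF h x] by (simp add: ln_mult)
  qed (use integrable_ln_mgf g h in auto)
  then show ?thesis using integrable_ln_mgf[OF h] by (simp add: log_mgf_def P.prob_space)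
qed

lemma log_mgf_const [simp]: "log_mgf (\<lambda>z. c) = c"
proof -
  have "log_mgf (\<lambda>z. c) = (\<integral>x. c \<partial>P)"
    unfolding log_mgf_def by (rule Bochner_Integration.integral_cong) (auto simp: mgf_const)
  then show ?thesis by (simp add: P.prob_space)
qed

lemma gibbs_density_measurable [measurable]:
  assumes [measurable]: "bounded_measurable h"
  shows "gibbs_density h \<in> borel_measurable (P \<Otimes>\<^sub>M B)"
  unfolding gibbs_density_def by measurable

lemma gibbs_density_pos:
  "bounded_measurable h \<Longrightarrow> z \<in> space R \<Longrightarrow> gibbs_density h z > 0"
  by (auto simp: gibbs_density_def space_R mgf_pos)

lemma sets_gibbs [measurable_cong]: "sets (gibbs h) = sets (P \<Otimes>\<^sub>M B)"
  by (simp add: gibbs_def sets_R)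

text \<open>
  The Gibbs density divides by the mass of each fibre, so integrating out the second coordinate leaves a
  ratio of fibre masses. For \<open>g = h\<close> the ratio is \<open>1\<close> and the first marginal is \<open>P\<close>; for general \<open>g\<close> it
  measures the change of \<open>log_mgf\<close> between \<open>h\<close> and \<open>g\<close>.
\<close>

lemma nn_integral_gibbs_exp:
  assumes h: "bounded_measurable h" and g: "bounded_measurable g"
    and A: "A \<in> sets P"
  shows "(\<integral>\<^sup>+z. ennreal (exp (g z - h z)) * indicator A (fst z) \<partial>gibbs h)
    = (\<integral>\<^sup>+x. ennreal (mgf g x / mgf h x) * indicator A x \<partial>P)"
proof -
  note [measurable] = g h A
  have "(\<integral>\<^sup>+z. ennreal (exp (g z - h z)) * indicator A (fst z) \<partial>gibbs h)
      = (\<integral>\<^sup>+z. ennreal (gibbs_density h z) * (ennreal (exp (g z - h z)) * indicator A (fst z)) \<partial>R)"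
    unfolding gibbs_def by (subst nn_integral_density) auto
  also have "\<dots> = (\<integral>\<^sup>+x. (\<integral>\<^sup>+y. ennreal (gibbs_density h (x, y)) *
      (ennreal (exp (g (x, y) - h (x, y))) * indicator A x) \<partial>K x) \<partial>P)"
    by (subst nn_integral_R) auto
  also have "\<dots> = (\<integral>\<^sup>+x. ennreal (mgf g x / mgf h x) * indicator A x \<partial>P)"
  proof (rule nn_integral_cong)
    fix x assume x: "x \<in> space P"
    note [measurable] = section_measurable[OF g x]
    have p: "mgf h x > 0" by (rule mgf_pos[OF h x])
    have "(\<integral>\<^sup>+y. ennreal (gibbs_density h (x, y)) *
        (ennreal (exp (g (x, y) - h (x, y))) * indicator A x) \<partial>K x)
      = (\<integral>\<^sup>+y. (ennreal (1 / mgf h x) * indicator A x) * ennreal (exp (g (x, y))) \<partial>K x)"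
      using p by (intro nn_integral_cong)
        (auto simp: gibbs_density_def exp_diff split: split_indicator simp flip: ennreal_mult)
    also have "\<dots> = (ennreal (1 / mgf h x) * indicator A x) * ennreal (mgf g x)"
      using x by (subst nn_integral_cmult) (auto simp: ennreal_mgf[OF g x])
    also have "\<dots> = ennreal (mgf g x / mgf h x) * indicator A x"
      using p mgf_pos[OF g x] by (auto split: split_indicator simp flip: ennreal_mult)
    finally show "(\<integral>\<^sup>+y. ennreal (gibbs_density h (x, y)) *
        (ennreal (exp (g (x, y) - h (x, y))) * indicator A x) \<partial>K x)
      = ennreal (mgf g x / mgf h x) * indicator A x" .
  qed
  finally show ?thesis .
qed

lemma distr_gibbs_fst:
  assumes h: "bounded_measurable h"
  shows "distr (gibbs h) P fst = P"
proof (rule measure_eqI)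
  fix A assume "A \<in> sets (distr (gibbs h) P fst)"
  then have A [measurable]: "A \<in> sets P" by simp
  have "emeasure (distr (gibbs h) P fst) A = (\<integral>\<^sup>+z. indicator A z \<partial>distr (gibbs h) P fst)"
    by simp
  also have "\<dots> = (\<integral>\<^sup>+z. ennreal (exp (h z - h z)) * indicator A (fst z) \<partial>gibbs h)"
    by (subst nn_integral_distr) auto
  also have "\<dots> = (\<integral>\<^sup>+x. ennreal (mgf h x / mgf h x) * indicator A x \<partial>P)"
    by (rule nn_integral_gibbs_exp[OF h h A])
  also have "\<dots> = (\<integral>\<^sup>+x. indicator A x \<partial>P)"
    using mgf_pos[OF h] by (intro nn_integral_cong) (simp add: order_less_imp_not_eq2)
  finally show "emeasure (distr (gibbs h) P fst) A = emeasure P A" by simp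
qed simp

lemma prob_space_gibbs:
  assumes h: "bounded_measurable h"
  shows "prob_space (gibbs h)"
  using prob_space_distrD[of fst "gibbs h" P] distr_gibbs_fst[OF h] prob_space_P by simp

lemma integral_gibbs_exp:
  assumes h: "bounded_measurable h" and g: "bounded_measurable g"
  shows "(\<integral>z. exp (g z - h z) \<partial>gibbs h) = (\<integral>x. mgf g x / mgf h x \<partial>P)"
proof -
  note [measurable] = g h
  have "(\<integral>\<^sup>+z. ennreal (exp (g z - h z)) \<partial>gibbs h)
      = (\<integral>\<^sup>+z. ennreal (exp (g z - h z)) * indicator (space P) (fst z) \<partial>gibbs h)"
    using sets_eq_imp_space_eq[OF sets_gibbs[of h]]
    by (intro nn_integral_cong) (auto simp: space_pair_measure)
  also have "\<dots> = (\<integral>\<^sup>+x. ennreal (mgf g x / mgf h x) * indicator (space P) x \<partial>P)"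
    by (rule nn_integral_gibbs_exp[OF h g]) simp
  also have "\<dots> = (\<integral>\<^sup>+x. ennreal (mgf g x / mgf h x) \<partial>P)"
    by (intro nn_integral_cong) auto
  finally have "(\<integral>\<^sup>+z. ennreal (exp (g z - h z)) \<partial>gibbs h) = (\<integral>\<^sup>+x. ennreal (mgf g x / mgf h x) \<partial>P)" .
  then show ?thesis
    by (subst (1 2) integral_eq_nn_integral)
      (auto intro!: AE_I2 divide_nonneg_nonneg simp: mgf_pos[OF g] mgf_pos[OF h] less_imp_le)
qed

lemma space_gibbs: "space (gibbs h) = space P \<times> space B"
  by (simp add: gibbs_def space_R)

text \<open>
  Second-order upper bound around \<open>h\<close>, whose derivative is integration against the Gibbs plan. On each
  fibre \<open>ln (mgf g / mgf h) \<le> mgf g / mgf h - 1\<close>, the ratio is an integral of \<open>exp (g - h)\<close> against the Gibbs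
  plan, and \<open>exp v \<le> 1 + v + v\<^sup>2\<close> for \<open>\<bar>v\<bar> \<le> 1\<close>.
\<close>

lemma log_mgf_smooth:
  assumes h: "bounded_measurable h" and g: "bounded_measurable g"
    and d: "\<And>x y. x \<in> space P \<Longrightarrow> y \<in> space B \<Longrightarrow> \<bar>g (x, y) - h (x, y)\<bar> \<le> d" and "d \<le> 1"
  shows "log_mgf g \<le> log_mgf h + (\<integral>z. g z - h z \<partial>gibbs h) + d\<^sup>2"
proof -
  interpret G: prob_space "gibbs h" by (rule prob_space_gibbs[OF h])
  have sG: "sets (gibbs h) = sets R" by (simp add: sets_gibbs sets_R)
  have gh: "bounded_measurable (\<lambda>z. g z - h z)" by (rule bounded_measurable_diff[OF g h])
  have int_gh: "integrable (gibbs h) (\<lambda>z. g z - h z)"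
    by (rule integrable_bounded_measurable[OF gh G.prob_space_axioms sG])
  have exp_int: "integrable (gibbs h) (\<lambda>z. exp (g z - h z))"
  proof (rule G.integrable_const_bound[of _ "exp 1"])
    show "AE z in gibbs h. norm (exp (g z - h z)) \<le> exp 1"
      using d \<open>d \<le> 1\<close> by (intro AE_I2) (fastforce simp: space_gibbs abs_le_iff)
  qed (use gh in \<open>auto simp: bounded_measurable_def\<close>)
  obtain C where C: "\<And>x y. x \<in> space P \<Longrightarrow> y \<in> space B \<Longrightarrow> \<bar>h (x, y)\<bar> \<le> C"
    using bounded_measurable_bound[OF h] by blast
  obtain D where D: "\<And>x y. x \<in> space P \<Longrightarrow> y \<in> space B \<Longrightarrow> \<bar>g (x, y)\<bar> \<le> D"
    using bounded_measurable_bound[OF g] by blast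
  have ratio_int: "integrable P (\<lambda>x. mgf g x / mgf h x)"
  proof (rule P.integrable_const_bound[of _ "exp D / exp (- C)"])
    show "AE x in P. norm (mgf g x / mgf h x) \<le> exp D / exp (- C)"
    proof (rule AE_I2)
      fix x assume x: "x \<in> space P"
      have "mgf g x / mgf h x \<le> exp D / exp (- C)"
        by (rule frac_le) (use mgf_bounds[OF h x C[OF x]] mgf_bounds[OF g x D[OF x]] in auto)
      then show "norm (mgf g x / mgf h x) \<le> exp D / exp (- C)"
        using mgf_pos[OF h x] mgf_pos[OF g x] by simp
    qed
  qed (use h g in measurable)
  have "log_mgf g - log_mgf h = (\<integral>x. ln (mgf g x) - ln (mgf h x) \<partial>P)"
    by (simp add: log_mgf_def integrable_ln_mgf g h)
  also have "\<dots> \<le> (\<integral>x. mgf g x / mgf h x - 1 \<partial>P)"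
  proof (intro integral_mono)
    fix x assume x: "x \<in> space P"
    have "ln (mgf g x) - ln (mgf h x) = ln (mgf g x / mgf h x)"
      using mgf_pos[OF h x] mgf_pos[OF g x] by (simp add: ln_div)
    also have "\<dots> \<le> mgf g x / mgf h x - 1"
      using mgf_pos[OF h x] mgf_pos[OF g x] by (intro ln_le_minus_one) simp
    finally show "ln (mgf g x) - ln (mgf h x) \<le> mgf g x / mgf h x - 1" .
  qed (use integrable_ln_mgf g h ratio_int in auto)
  also have "\<dots> = (\<integral>z. exp (g z - h z) \<partial>gibbs h) - 1"
    using ratio_int by (simp add: P.prob_space integral_gibbs_exp[OF h g])
  also have "\<dots> \<le> (\<integral>z. 1 + (g z - h z) + d\<^sup>2 \<partial>gibbs h) - 1"
  proof (intro diff_right_mono integral_mono)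
    fix z assume "z \<in> space (gibbs h)"
    then have z: "\<bar>g z - h z\<bar> \<le> d" using d by (auto simp: space_gibbs)
    then have "(g z - h z)\<^sup>2 \<le> d\<^sup>2" by (metis abs_ge_zero power2_abs power_mono)
    then show "exp (g z - h z) \<le> 1 + (g z - h z) + d\<^sup>2"
      using exp_le_quadratic[of "g z - h z"] z \<open>d \<le> 1\<close> by linarith
  qed (use exp_int int_gh in auto)
  also have "\<dots> = (\<integral>z. g z - h z \<partial>gibbs h) + d\<^sup>2"
    using int_gh by (subst Bochner_Integration.integral_add)
      (auto simp: G.prob_space)
  finally show ?thesis by simp
qed

lemma integral_ln_mgf_fst:
  assumes h: "bounded_measurable h" and \<pi>: "sets \<pi> = sets R" "distr \<pi> P fst = P"
  shows "(\<integral>z. ln (mgf h (fst z)) \<partial>\<pi>) = log_mgf h"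
proof -
  have "log_mgf h = (\<integral>x. ln (mgf h x) \<partial>distr \<pi> P fst)" by (simp add: log_mgf_def \<pi>(2))
  also have "\<dots> = (\<integral>z. ln (mgf h (fst z)) \<partial>\<pi>)"
    by (rule integral_distr)
      (use h in \<open>auto simp: measurable_cong_sets[OF \<pi>(1) refl] measurable_cong_sets[OF sets_R refl]\<close>)
  finally show ?thesis ..
qed

lemma ln_gibbs_density:
  assumes "bounded_measurable h" "z \<in> space R"
  shows "ln (gibbs_density h z) = h z - ln (mgf h (fst z))"
  using assms mgf_pos[OF assms(1), of "fst z"] by (auto simp: gibbs_density_def space_R ln_div)

lemma rel_entropy_gibbs:
  assumes h: "bounded_measurable h"
  shows "rel_entropy R (gibbs h) = ereal ((\<integral>z. h z \<partial>gibbs h) - log_mgf h)"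
proof -
  have pG: "prob_space (gibbs h)" by (rule prob_space_gibbs[OF h])
  have sG: "sets (gibbs h) = sets R" by (simp add: sets_gibbs sets_R)
  have bm: "bounded_measurable (\<lambda>z. h z - ln (mgf h (fst z)))"
    by (intro bounded_measurable_diff bounded_measurable_ln_mgf h)
  have int: "integrable (gibbs h) (\<lambda>z. h z - ln (mgf h (fst z)))"
    by (rule integrable_bounded_measurable[OF bm pG sG])
  have eq: "z \<in> space (gibbs h) \<Longrightarrow> ln (gibbs_density h z) = h z - ln (mgf h (fst z))" for z
    using ln_gibbs_density[OF h] by (simp add: space_gibbs space_R)
  have "rel_entropy R (gibbs h) = ereal (\<integral>z. ln (gibbs_density h z) \<partial>gibbs h)"
    unfolding gibbs_def
  proof (rule rel_entropy_density)
    show "integrable (density R (gibbs_density h)) (\<lambda>x. ln (gibbs_density h x))"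
      using int unfolding gibbs_def[symmetric]
      by (subst Bochner_Integration.integrable_cong[OF refl eq]) auto
  qed (use gibbs_density_pos[OF h] gibbs_density_measurable[OF h] R.sigma_finite_measure_axioms in
      \<open>auto simp: measurable_cong_sets[OF sets_R refl]\<close>)
  also have "(\<integral>z. ln (gibbs_density h z) \<partial>gibbs h) = (\<integral>z. h z - ln (mgf h (fst z)) \<partial>gibbs h)"
    by (rule Bochner_Integration.integral_cong[OF refl eq])
  also have "\<dots> = (\<integral>z. h z \<partial>gibbs h) - log_mgf h"
    using integrable_bounded_measurable[OF _ pG sG] h bounded_measurable_ln_mgf[OF h]
    by (simp add: integral_ln_mgf_fst[OF h sG distr_gibbs_fst[OF h]])
  finally show ?thesis .
qed

text \<open>
  Since \<open>\<pi>\<close> has first marginal \<open>P\<close>, the fibre normalization \<open>ln (mgf h)\<close> integrates to \<open>log_mgf h\<close> under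
  \<open>\<pi>\<close>; the rest is the comparison of \<open>\<pi>\<close> with the Gibbs density.
\<close>

lemma donsker_varadhan:
  assumes h: "bounded_measurable h"
    and \<pi>: "prob_space \<pi>" "sets \<pi> = sets R" "distr \<pi> P fst = P"
  shows "ereal ((\<integral>z. h z \<partial>\<pi>) - log_mgf h) \<le> rel_entropy R \<pi>"
proof -
  have int: "integrable \<pi> h" "integrable \<pi> (\<lambda>z. ln (mgf h (fst z)))"
    using integrable_bounded_measurable[OF _ \<pi>(1,2)] h bounded_measurable_ln_mgf[OF h] by auto
  have "(\<integral>\<^sup>+z. ennreal (exp (h z - ln (mgf h (fst z)))) \<partial>R) = (\<integral>\<^sup>+z. ennreal (gibbs_density h z) \<partial>R)"
    using mgf_pos[OF h] by (intro nn_integral_cong)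
      (auto simp: gibbs_density_def space_R exp_diff)
  also have "\<dots> = emeasure (gibbs h) (space R)"
    using h unfolding gibbs_def
    by (subst emeasure_density) (auto intro!: nn_integral_cong)
  also have "\<dots> = 1"
    using prob_space.emeasure_space_1[OF prob_space_gibbs[OF h]] by (simp add: gibbs_def)
  finally have "ereal (\<integral>z. h z - ln (mgf h (fst z)) \<partial>\<pi>) \<le> rel_entropy R \<pi>"
    by (intro rel_entropy_lower_bound R.sigma_finite_measure_axioms \<pi>
        Bochner_Integration.integrable_diff int) simp
  then show ?thesis using int by (simp add: integral_ln_mgf_fst[OF h \<pi>(2,3)])
qed

text \<open>
  The Gibbs plan of \<open>h\<close> attains equality in the variational inequality at \<open>h\<close> and satisfies it at \<open>g\<close>;
  subtracting the two removes the entropy. This is convexity of \<open>log_mgf\<close> in differential form.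
\<close>

lemma log_mgf_subgradient:
  assumes h: "bounded_measurable h" and g: "bounded_measurable g"
  shows "log_mgf h + (\<integral>z. g z - h z \<partial>gibbs h) \<le> log_mgf g"
proof -
  have pG: "prob_space (gibbs h)" by (rule prob_space_gibbs[OF h])
  have sG: "sets (gibbs h) = sets R" by (simp add: sets_gibbs sets_R)
  have "(\<integral>z. g z \<partial>gibbs h) - log_mgf g \<le> (\<integral>z. h z \<partial>gibbs h) - log_mgf h"
    using donsker_varadhan[OF g pG sG distr_gibbs_fst[OF h]] rel_entropy_gibbs[OF h] by simp
  then show ?thesis using integrable_bounded_measurable[OF _ pG sG] g h by simp
qed

lemma log_mgf_convex:
  assumes k: "bounded_measurable k" and u: "bounded_measurable u" and s: "0 \<le> s" "s \<le> 1"
  shows "log_mgf (\<lambda>z. k z + s * u z) \<le> s * log_mgf (\<lambda>z. k z + u z) + (1 - s) * log_mgf k"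
proof -
  let ?h = "\<lambda>z. k z + s * u z"
  have h: "bounded_measurable ?h"
    by (intro bounded_measurable_add bounded_measurable_cmult k u)
  \<comment> \<open>The slope of \<open>s \<mapsto> log_mgf (k + s u)\<close> at the intermediate point.\<close>
  define p where "p = (\<integral>z. u z \<partial>gibbs ?h)"
  have 1: "log_mgf ?h + (1 - s) * p \<le> log_mgf (\<lambda>z. k z + u z)"
  proof -
    have "(\<integral>z. (k z + u z) - ?h z \<partial>gibbs ?h) = (\<integral>z. (1 - s) * u z \<partial>gibbs ?h)"
      by (intro Bochner_Integration.integral_cong) (auto simp: algebra_simps)
    then show ?thesis
      using log_mgf_subgradient[OF h bounded_measurable_add[OF k u]] by (simp add: p_def)
  qed
  have 2: "log_mgf ?h - s * p \<le> log_mgf k"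
    using log_mgf_subgradient[OF h k] by (simp add: p_def)
  have "s * (log_mgf ?h + (1 - s) * p) + (1 - s) * (log_mgf ?h - s * p)
      \<le> s * log_mgf (\<lambda>z. k z + u z) + (1 - s) * log_mgf k"
    by (intro add_mono mult_left_mono 1 2) (use s in auto)
  then show ?thesis by (simp add: algebra_simps)
qed

text \<open>
  By convexity the difference quotient \<open>t (log_mgf (k + u / t) - log_mgf k)\<close> increases as \<open>t\<close> decreases to
  \<open>0\<close>, and it is bounded by the supremum of \<open>u\<close>.
\<close>

lemma scaled_log_mgf_converges:
  assumes k: "bounded_measurable k" and u: "bounded_measurable u"
  shows "\<exists>L. ((\<lambda>t. t * log_mgf (\<lambda>z. k z + u z / t)) \<longlongrightarrow> L) (at_right 0)"
proof -
  define \<phi> where "\<phi> t = t * (log_mgf (\<lambda>z. k z + u z / t) - log_mgf k)" for t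
  have anti: "\<phi> t' \<le> \<phi> t" if t: "0 < t" "t \<le> t'" for t t'
  proof -
    have "log_mgf (\<lambda>z. k z + (t / t') * (u z / t))
        \<le> (t / t') * log_mgf (\<lambda>z. k z + u z / t) + (1 - t / t') * log_mgf k"
      by (rule log_mgf_convex[OF k bounded_measurable_divide[OF u]]) (use t in auto)
    then have "log_mgf (\<lambda>z. k z + u z / t') - log_mgf k
        \<le> (t / t') * (log_mgf (\<lambda>z. k z + u z / t) - log_mgf k)"
      using t by (simp add: algebra_simps)
    then have "t' * (log_mgf (\<lambda>z. k z + u z / t') - log_mgf k)
        \<le> t' * ((t / t') * (log_mgf (\<lambda>z. k z + u z / t) - log_mgf k))"
      by (rule mult_left_mono) (use t in auto)
    then show ?thesis using t by (simp add: \<phi>_def)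
  qed
  obtain C where C: "\<And>x y. x \<in> space P \<Longrightarrow> y \<in> space B \<Longrightarrow> \<bar>u (x, y)\<bar> \<le> C"
    using bounded_measurable_bound[OF u] by blast
  have bound: "\<phi> t \<le> C" if t: "0 < t" for t
  proof -
    have "log_mgf (\<lambda>z. k z + u z / t) \<le> log_mgf k + C / t"
      by (intro log_mgf_mono_shift bounded_measurable_add bounded_measurable_divide k u)
        (use t C in \<open>auto simp: abs_le_iff divide_right_mono\<close>)
    then show ?thesis using t by (simp add: \<phi>_def field_simps)
  qed
  define S where "S = (SUP t\<in>{0<..}. \<phi> t)"
  have bdd: "bdd_above (\<phi> ` {0<..})" using bound by (auto intro!: bdd_aboveI[of _ C])
  have "(\<phi> \<longlongrightarrow> S) (at_right 0)"
  proof (rule order_tendstoI)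
    fix a assume "a < S"
    then obtain t0 where t0: "t0 > 0" "a < \<phi> t0"
      using less_cSUP_iff[OF _ bdd, of a] by (auto simp: S_def)
    have "a < \<phi> t" if "0 < t" "t < t0" for t
      using anti[of t t0] that t0 by linarith
    then show "eventually (\<lambda>t. a < \<phi> t) (at_right 0)"
      unfolding eventually_at_right_field using t0 by blast
  next
    fix a assume "S < a"
    moreover have "\<phi> t \<le> S" if "t > 0" for t
      unfolding S_def using that by (intro cSUP_upper bdd) auto
    ultimately show "eventually (\<lambda>t. \<phi> t < a) (at_right 0)"
      by (intro eventually_at_rightI[of 0 1]) (auto intro: le_less_trans)
  qed
  then have "((\<lambda>t. \<phi> t + t * log_mgf k) \<longlongrightarrow> S + 0 * log_mgf k) (at_right 0)"
    by (intro tendsto_intros)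
  then show ?thesis by (auto simp: \<phi>_def algebra_simps)
qed

end

section \<open>Duality for plans with a fixed first marginal\<close>

text \<open>
  All values below are those of the original problem multiplied by \<open>1 - \<beta>\<close>, which keeps the coefficient
  of the integrals equal to \<open>1\<close>.
\<close>

locale entropic_cvar_problem = kernel_coupling P B K R
  for P :: "'a measure" and B :: "'b measure" and K R +
  fixes c :: "'a \<times> 'b \<Rightarrow> real" and f :: "'b \<Rightarrow> real" and C \<epsilon> \<beta> m :: real
  assumes c_bm: "bounded_measurable c"
    and c_nonneg: "\<And>z. c z \<ge> 0"
    and f_measurable [measurable]: "f \<in> borel_measurable B"
    and f_bound: "\<And>y. y \<in> space B \<Longrightarrow> \<bar>f y\<bar> \<le> C"
    and \<epsilon>_pos: "\<epsilon> > 0" and \<beta>_pos: "0 < \<beta>" and \<beta>_less_1: "\<beta> < 1"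
begin

definition transport_plans :: "('a \<times> 'b) measure set" where
  "transport_plans = {\<pi>. prob_space \<pi> \<and> sets \<pi> = sets R \<and> distr \<pi> P fst = P}"

definition regularized_cost :: "('a \<times> 'b) measure \<Rightarrow> ereal" where
  "regularized_cost \<pi> = ereal (\<integral>z. c z \<partial>\<pi>) + ereal \<epsilon> * rel_entropy R \<pi>"

definition excess :: "real \<Rightarrow> 'a \<times> 'b \<Rightarrow> real" where
  "excess a z = max (f (snd z) - a) 0"

definition tilt :: "real \<Rightarrow> real \<Rightarrow> 'a \<times> 'b \<Rightarrow> real" where
  "tilt l a z = (excess a z - l * c z) / (l * \<epsilon>)"

definition primal_value :: "('a \<times> 'b) measure \<Rightarrow> real \<Rightarrow> real" where
  "primal_value \<pi> a = (1 - \<beta>) * a + (\<integral>z. excess a z \<partial>\<pi>)"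

definition dual_value :: "real \<Rightarrow> real \<Rightarrow> real" where
  "dual_value l a = (1 - \<beta>) * a + l * m + l * \<epsilon> * log_mgf (tilt l a)"

lemma C_nonneg: "0 \<le> C"
proof -
  obtain x where "x \<in> space P" using P.not_empty by auto
  then obtain y where "y \<in> space B"
    using prob_space.not_empty[OF prob_space_kernel] space_kernel by blast
  then show ?thesis using f_bound[of y] by linarith
qed

lemma excess_bound: "y \<in> space B \<Longrightarrow> \<bar>excess a (x, y)\<bar> \<le> C + \<bar>a\<bar>"
  using f_bound[of y] C_nonneg by (auto simp: excess_def)

lemma excess_bm: "bounded_measurable (excess a)"
proof -
  have "excess a \<in> borel_measurable (P \<Otimes>\<^sub>M B)" unfolding excess_def by measurable
  then show ?thesis using excess_bound unfolding bounded_measurable_def by blast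
qed

lemma tilt_bm: "bounded_measurable (tilt l a)"
  unfolding tilt_def
  by (intro bounded_measurable_divide bounded_measurable_diff bounded_measurable_cmult excess_bm c_bm)

lemma tilt_eq:
  assumes "l > 0"
  shows "tilt l a z = excess a z / (l * \<epsilon>) - c z / \<epsilon>"
  using assms \<epsilon>_pos by (simp add: tilt_def field_simps)

lemma plan_integrable:
  assumes "\<pi> \<in> transport_plans" "bounded_measurable h"
  shows "integrable \<pi> h"
  using assms integrable_bounded_measurable by (auto simp: transport_plans_def)

lemma integral_tilt:
  assumes \<pi>: "\<pi> \<in> transport_plans" and l: "l > 0"
  shows "l * \<epsilon> * (\<integral>z. tilt l a z \<partial>\<pi>) = (\<integral>z. excess a z \<partial>\<pi>) - l * (\<integral>z. c z \<partial>\<pi>)"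
proof -
  have "l * \<epsilon> * (\<integral>z. tilt l a z \<partial>\<pi>) = (\<integral>z. l * \<epsilon> * tilt l a z \<partial>\<pi>)" by simp
  also have "\<dots> = (\<integral>z. excess a z - l * c z \<partial>\<pi>)"
    using l \<epsilon>_pos by (intro Bochner_Integration.integral_cong) (auto simp: tilt_def)
  also have "\<dots> = (\<integral>z. excess a z \<partial>\<pi>) - l * (\<integral>z. c z \<partial>\<pi>)"
    using plan_integrable[OF \<pi>] excess_bm c_bm by simp
  finally show ?thesis .
qed

lemma gibbs_transport_plan:
  "bounded_measurable h \<Longrightarrow> gibbs h \<in> transport_plans"
  by (simp add: transport_plans_def prob_space_gibbs sets_gibbs sets_R distr_gibbs_fst)

text \<open>
  The budget \<open>r\<close> is independent of \<open>m\<close> so that plans that are only nearly optimal for the transport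
  problem, with cost slightly above \<open>m\<close>, are covered.
\<close>

lemma weak_duality:
  assumes \<pi>: "\<pi> \<in> transport_plans" and cost: "regularized_cost \<pi> \<le> ereal r" and l: "l > 0"
  shows "primal_value \<pi> a \<le> (1 - \<beta>) * a + l * r + l * \<epsilon> * log_mgf (tilt l a)"
proof -
  have "ereal ((\<integral>z. tilt l a z \<partial>\<pi>) - log_mgf (tilt l a)) \<le> rel_entropy R \<pi>"
    using \<pi> by (intro donsker_varadhan tilt_bm) (auto simp: transport_plans_def)
  then have "ereal (\<integral>z. c z \<partial>\<pi>) + ereal \<epsilon> * ereal ((\<integral>z. tilt l a z \<partial>\<pi>) - log_mgf (tilt l a))
      \<le> regularized_cost \<pi>"
    unfolding regularized_cost_def using \<epsilon>_pos
    by (intro add_left_mono ereal_mult_left_mono) auto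
  also note cost
  finally have "(\<integral>z. c z \<partial>\<pi>) + \<epsilon> * ((\<integral>z. tilt l a z \<partial>\<pi>) - log_mgf (tilt l a)) \<le> r"
    by simp
  then have "l * ((\<integral>z. c z \<partial>\<pi>) + \<epsilon> * ((\<integral>z. tilt l a z \<partial>\<pi>) - log_mgf (tilt l a))) \<le> l * r"
    using l by (intro mult_left_mono) auto
  then show ?thesis
    using integral_tilt[OF \<pi> l, of a] by (simp add: primal_value_def algebra_simps)
qed

definition gibbs_cost :: "real \<Rightarrow> real \<Rightarrow> real" where
  "gibbs_cost l a = (\<integral>z. c z \<partial>gibbs (tilt l a))
     + \<epsilon> * ((\<integral>z. tilt l a z \<partial>gibbs (tilt l a)) - log_mgf (tilt l a))"

lemma regularized_cost_gibbs:
  assumes "bounded_measurable h"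
  shows "regularized_cost (gibbs h)
    = ereal ((\<integral>z. c z \<partial>gibbs h) + \<epsilon> * ((\<integral>z. h z \<partial>gibbs h) - log_mgf h))"
  by (simp add: regularized_cost_def rel_entropy_gibbs[OF assms])

lemma regularized_cost_gibbs_tilt: "regularized_cost (gibbs (tilt l a)) = ereal (gibbs_cost l a)"
  by (simp add: regularized_cost_gibbs[OF tilt_bm] gibbs_cost_def)

lemma gibbs_cost_nonneg: "0 \<le> gibbs_cost l a"
proof -
  have "ereal ((\<integral>z. 0 \<partial>gibbs (tilt l a)) - log_mgf (\<lambda>z. 0)) \<le> rel_entropy R (gibbs (tilt l a))"
    using gibbs_transport_plan[OF tilt_bm, of l a]
    by (intro donsker_varadhan) (auto simp: transport_plans_def)
  then have "0 \<le> (\<integral>z. tilt l a z \<partial>gibbs (tilt l a)) - log_mgf (tilt l a)"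
    by (simp add: rel_entropy_gibbs[OF tilt_bm] zero_ereal_def)
  then show ?thesis
    using \<epsilon>_pos c_nonneg by (simp add: gibbs_cost_def)
qed

text \<open>
  The Gibbs plan of the tilt maximizes the Lagrangian \<open>primal_value \<pi> a + l (m - J \<pi>)\<close> over all plans, and
  the dual function is this maximum.
\<close>

lemma dual_value_eq_lagrangian:
  assumes "l > 0"
  shows "dual_value l a = primal_value (gibbs (tilt l a)) a + l * (m - gibbs_cost l a)"
  using integral_tilt[OF gibbs_transport_plan[OF tilt_bm] assms, of l a a]
  by (simp add: dual_value_def primal_value_def gibbs_cost_def algebra_simps)

text \<open>
  The Lagrangian of one fixed Gibbs plan, as a function of \<open>(l', a')\<close>, is the first-order model of the dual
  function; smoothness of \<open>log_mgf\<close> bounds the dual function by it up to a quadratic error.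
\<close>

lemma dual_value_le_lagrangian:
  assumes l: "l > 0" and l': "l' > 0"
    and d: "\<And>x y. x \<in> space P \<Longrightarrow> y \<in> space B \<Longrightarrow> \<bar>tilt l' a' (x, y) - tilt l a (x, y)\<bar> \<le> d" "d \<le> 1"
  shows "dual_value l' a' \<le> primal_value (gibbs (tilt l a)) a' + l' * (m - gibbs_cost l a) + l' * \<epsilon> * d\<^sup>2"
proof -
  let ?\<pi> = "gibbs (tilt l a)"
  have \<pi>: "?\<pi> \<in> transport_plans" by (rule gibbs_transport_plan[OF tilt_bm])
  have "log_mgf (tilt l' a') \<le> log_mgf (tilt l a) + (\<integral>z. tilt l' a' z - tilt l a z \<partial>?\<pi>) + d\<^sup>2"
    by (rule log_mgf_smooth[OF tilt_bm tilt_bm d])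
  also have "(\<integral>z. tilt l' a' z - tilt l a z \<partial>?\<pi>) = (\<integral>z. tilt l' a' z \<partial>?\<pi>) - (\<integral>z. tilt l a z \<partial>?\<pi>)"
    using plan_integrable[OF \<pi> tilt_bm] by simp
  finally have "l' * \<epsilon> * log_mgf (tilt l' a') \<le> l' * \<epsilon> *
      (log_mgf (tilt l a) + ((\<integral>z. tilt l' a' z \<partial>?\<pi>) - (\<integral>z. tilt l a z \<partial>?\<pi>)) + d\<^sup>2)"
    using l' \<epsilon>_pos by (intro mult_left_mono) auto
  then show ?thesis
    using integral_tilt[OF \<pi> l', of a']
    by (simp add: dual_value_def primal_value_def gibbs_cost_def algebra_simps)
qed

lemma excess_lipschitz:
  fixes z :: "'a \<times> 'b"
  shows "\<bar>excess a z - excess a' z\<bar> \<le> \<bar>a - a'\<bar>"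
  by (auto simp: excess_def)

lemma tilt_diff_bound:
  assumes l: "l > 0" and l': "l' > 0" and y: "y \<in> space B"
  shows "\<bar>tilt l' a' (x, y) - tilt l a (x, y)\<bar>
    \<le> \<bar>a' - a\<bar> / (l' * \<epsilon>) + (C + \<bar>a\<bar>) / \<epsilon> * \<bar>1 / l' - 1 / l\<bar>"
proof -
  have "tilt l' a' (x, y) - tilt l a (x, y)
      = (excess a' (x, y) - excess a (x, y)) / (l' * \<epsilon>) + excess a (x, y) / \<epsilon> * (1 / l' - 1 / l)"
    using l l' \<epsilon>_pos by (simp add: tilt_eq field_simps)
  also have "\<bar>\<dots>\<bar> \<le> \<bar>(excess a' (x, y) - excess a (x, y)) / (l' * \<epsilon>)\<bar>
      + \<bar>excess a (x, y) / \<epsilon> * (1 / l' - 1 / l)\<bar>" by (rule abs_triangle_ineq)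
  also have "\<bar>(excess a' (x, y) - excess a (x, y)) / (l' * \<epsilon>)\<bar> \<le> \<bar>a' - a\<bar> / (l' * \<epsilon>)"
    using l' \<epsilon>_pos excess_lipschitz[of a' "(x, y)" a]
    by (simp add: abs_mult divide_right_mono)
  also have "\<bar>excess a (x, y) / \<epsilon> * (1 / l' - 1 / l)\<bar> \<le> (C + \<bar>a\<bar>) / \<epsilon> * \<bar>1 / l' - 1 / l\<bar>"
    unfolding abs_mult using \<epsilon>_pos excess_bound[OF y, of a x]
    by (intro mult_right_mono) (auto simp: divide_right_mono)
  finally show ?thesis by simp
qed

lemma primal_value_convex:
  assumes \<pi>: "\<pi> \<in> transport_plans" and s: "0 \<le> s" "s \<le> 1"
  shows "primal_value \<pi> (a + s * (a' - a)) \<le> (1 - s) * primal_value \<pi> a + s * primal_value \<pi> a'"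
proof -
  have "(\<integral>z. excess (a + s * (a' - a)) z \<partial>\<pi>) \<le> (\<integral>z. (1 - s) * excess a z + s * excess a' z \<partial>\<pi>)"
  proof (rule integral_mono)
    fix z :: "'a \<times> 'b"
    let ?v = "f (snd z)"
    have "?v - (a + s * (a' - a)) = (1 - s) * (?v - a) + s * (?v - a')"
      by (simp add: algebra_simps)
    also have "\<dots> \<le> (1 - s) * excess a z + s * excess a' z"
      using s by (intro add_mono mult_left_mono) (auto simp: excess_def)
    finally show "excess (a + s * (a' - a)) z \<le> (1 - s) * excess a z + s * excess a' z"
      using s by (auto simp: excess_def)
  qed (use plan_integrable[OF \<pi> excess_bm] in auto)
  also have "\<dots> = (1 - s) * (\<integral>z. excess a z \<partial>\<pi>) + s * (\<integral>z. excess a' z \<partial>\<pi>)"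
    using plan_integrable[OF \<pi> excess_bm] by simp
  finally show ?thesis by (simp add: primal_value_def algebra_simps)
qed

text \<open>
  A minimizer of the dual function over \<open>{\<eta>..} \<times> UNIV\<close> also minimizes the Lagrangian of its own Gibbs plan
  over that set. Along the segment towards \<open>(t, b)\<close> the Lagrangian decreases at least linearly if its value
  at \<open>(t, b)\<close> is smaller, by convexity, and the quadratic error cannot make up for this.
\<close>

lemma first_order_optimality:
  assumes \<eta>: "\<eta> > 0" "l \<ge> \<eta>" and min: "\<And>l' a'. l' \<ge> \<eta> \<Longrightarrow> dual_value l a \<le> dual_value l' a'"
    and t: "t \<ge> \<eta>"
  shows "0 \<le> primal_value (gibbs (tilt l a)) b - primal_value (gibbs (tilt l a)) a
    + (t - l) * (m - gibbs_cost l a)"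
proof -
  let ?\<pi> = "gibbs (tilt l a)" and ?J = "gibbs_cost l a"
  \<comment> \<open>Bounds the rate of change of the tilt along the segment from \<open>(l, a)\<close> to \<open>(t, b)\<close>.\<close>
  define D where "D = \<bar>b - a\<bar> / (\<eta> * \<epsilon>) + (C + \<bar>a\<bar>) / \<epsilon> * (\<bar>t - l\<bar> / \<eta>\<^sup>2)"
  have D: "D \<ge> 0" using \<eta> \<epsilon>_pos C_nonneg by (simp add: D_def)
  show ?thesis
  proof (rule nonneg_of_quadratic_lower_bound)
    show "0 < 1 / (D + 1)" using D by simp
    fix s :: real assume s: "0 < s" "s \<le> 1 / (D + 1)"
    have s1: "s \<le> 1" using s D by (smt (verit) divide_le_eq_1)
    have sD: "s * D \<le> 1" using s D by (simp add: field_simps)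
    define l' a' where "l' = l + s * (t - l)" and "a' = a + s * (b - a)"
    have l': "l' \<ge> \<eta>"
    proof -
      have "l' = (1 - s) * l + s * t" by (simp add: l'_def algebra_simps)
      also have "\<dots> \<ge> (1 - s) * \<eta> + s * \<eta>"
        using s s1 \<eta> t by (intro add_mono mult_left_mono) auto
      finally show ?thesis by (simp add: algebra_simps)
    qed
    have "\<bar>tilt l' a' (x, y) - tilt l a (x, y)\<bar> \<le> s * D" if "y \<in> space B" for x y
    proof -
      have "1 / l' - 1 / l = (l - l') / (l' * l)" using l' \<eta> by (simp add: field_simps)
      then have "\<bar>1 / l' - 1 / l\<bar> = s * \<bar>t - l\<bar> / (l' * l)"
        using l' \<eta> s by (simp add: l'_def abs_mult)
      also have "\<dots> \<le> s * \<bar>t - l\<bar> / \<eta>\<^sup>2"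
        using l' \<eta> s by (intro divide_left_mono) (auto simp: power2_eq_square intro!: mult_mono)
      finally have 1: "\<bar>1 / l' - 1 / l\<bar> \<le> s * \<bar>t - l\<bar> / \<eta>\<^sup>2" .
      have "\<bar>a' - a\<bar> / (l' * \<epsilon>) \<le> s * \<bar>b - a\<bar> / (\<eta> * \<epsilon>)"
        using l' \<eta> s \<epsilon>_pos by (auto simp: a'_def abs_mult intro!: divide_left_mono)
      moreover have "(C + \<bar>a\<bar>) / \<epsilon> * \<bar>1 / l' - 1 / l\<bar> \<le> (C + \<bar>a\<bar>) / \<epsilon> * (s * \<bar>t - l\<bar> / \<eta>\<^sup>2)"
        using 1 C_nonneg \<epsilon>_pos by (intro mult_left_mono) auto
      ultimately show ?thesis
        using tilt_diff_bound[of l l' y a' x a] l' \<eta> that by (simp add: D_def algebra_simps)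
    qed
    then have "dual_value l' a' \<le> primal_value ?\<pi> a' + l' * (m - ?J) + l' * \<epsilon> * (s * D)\<^sup>2"
      using l' \<eta> sD by (intro dual_value_le_lagrangian) auto
    moreover have "l' * \<epsilon> * (s * D)\<^sup>2 \<le> (l + \<bar>t - l\<bar>) * \<epsilon> * (s * D)\<^sup>2"
    proof -
      have "s * (t - l) \<le> s * \<bar>t - l\<bar>" using s by (intro mult_left_mono) auto
      also have "\<dots> \<le> \<bar>t - l\<bar>" using s s1 by (intro mult_left_le_one_le) auto
      finally have "s * (t - l) \<le> \<bar>t - l\<bar>" .
      then show ?thesis using \<epsilon>_pos by (intro mult_right_mono) (auto simp: l'_def)
    qed
    moreover have "primal_value ?\<pi> a' \<le> (1 - s) * primal_value ?\<pi> a + s * primal_value ?\<pi> b"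
      unfolding a'_def using s s1 by (intro primal_value_convex gibbs_transport_plan tilt_bm) auto
    moreover have "dual_value l a \<le> dual_value l' a'" by (rule min[OF l'])
    moreover have "dual_value l a = primal_value ?\<pi> a + l * (m - ?J)"
      using \<eta> by (intro dual_value_eq_lagrangian) auto
    ultimately show "0 \<le> s * (primal_value ?\<pi> b - primal_value ?\<pi> a + (t - l) * (m - ?J))
        + s\<^sup>2 * ((l + \<bar>t - l\<bar>) * \<epsilon> * D\<^sup>2)"
      by (simp add: l'_def algebra_simps power_mult_distrib)
  qed
qed

text \<open>
  Outside \<open>[-C, C]\<close> the excess is affine in \<open>a\<close> on the range of \<open>f\<close>: it vanishes above \<open>C\<close>, where the dual
  value has slope \<open>1 - \<beta>\<close>, and has slope \<open>- 1\<close> below \<open>- C\<close>, where the dual value has slope \<open>- \<beta>\<close>.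
\<close>

lemma dual_value_clamp:
  assumes l: "l > 0"
  shows "dual_value l (max (- C) (min a C)) \<le> dual_value l a"
proof (cases "a < - C")
  case True
  have "log_mgf (tilt l (- C)) \<le> log_mgf (tilt l a) + (a + C) / (l * \<epsilon>)"
  proof (intro log_mgf_mono_shift tilt_bm)
    fix x y assume y: "y \<in> space B"
    then have "excess (- C) (x, y) = excess a (x, y) + (a + C)"
      using f_bound[OF y] True by (auto simp: excess_def)
    then show "tilt l (- C) (x, y) \<le> tilt l a (x, y) + (a + C) / (l * \<epsilon>)"
      using l by (simp add: tilt_eq add_divide_distrib)
  qed
  then have "l * \<epsilon> * log_mgf (tilt l (- C)) \<le> l * \<epsilon> * (log_mgf (tilt l a) + (a + C) / (l * \<epsilon>))"
    using l \<epsilon>_pos by (intro mult_left_mono) auto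
  also have "\<dots> = l * \<epsilon> * log_mgf (tilt l a) + (a + C)"
    using l \<epsilon>_pos by (simp add: field_simps)
  finally have "dual_value l (- C) \<le> dual_value l a + \<beta> * (a + C)"
    by (simp add: dual_value_def algebra_simps)
  moreover have "\<beta> * (a + C) \<le> 0" using True \<beta>_pos by (simp add: mult_le_0_iff)
  moreover have "max (- C) (min a C) = - C" using True C_nonneg by simp
  ultimately show ?thesis by simp
next
  case False
  show ?thesis
  proof (cases "a > C")
    case True
    have "log_mgf (tilt l C) \<le> log_mgf (tilt l a) + 0"
    proof (intro log_mgf_mono_shift tilt_bm)
      fix x y assume y: "y \<in> space B"
      then have "excess C (x, y) = excess a (x, y)"
        using f_bound[OF y] True by (auto simp: excess_def)
      then show "tilt l C (x, y) \<le> tilt l a (x, y) + 0"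
        using l by (simp add: tilt_eq)
    qed
    moreover have "(1 - \<beta>) * C \<le> (1 - \<beta>) * a" using True \<beta>_less_1 by simp
    ultimately have "dual_value l C \<le> dual_value l a"
      using l \<epsilon>_pos by (auto simp: dual_value_def intro!: add_mono mult_left_mono)
    moreover have "max (- C) (min a C) = C" using True C_nonneg by simp
    ultimately show ?thesis by simp
  next
    case nC: False
    then have "max (- C) (min a C) = a" using False by simp
    then show ?thesis by simp
  qed
qed

lemma continuous_on_dual_value: "continuous_on ({0<..} \<times> UNIV) (\<lambda>(l, a). dual_value l a)"
proof -
  have "continuous_on ({0<..} \<times> UNIV) (\<lambda>p. log_mgf (tilt (fst p) (snd p)))"
    unfolding continuous_on_def
  proof
    fix p :: "real \<times> real" assume "p \<in> {0<..} \<times> UNIV"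
    then obtain l a where p: "p = (l, a)" and l: "l > 0" by auto
    let ?F = "at p within ({0<..} \<times> UNIV)"
    let ?b = "\<lambda>q. \<bar>snd q - a\<bar> / (fst q * \<epsilon>) + (C + \<bar>a\<bar>) / \<epsilon> * \<bar>1 / fst q - 1 / l\<bar>"
    have ev: "eventually (\<lambda>q. q \<in> {0<..} \<times> UNIV) ?F"
      by (simp add: eventually_at_filter)
    have "eventually (\<lambda>q. norm (log_mgf (tilt (fst q) (snd q)) - log_mgf (tilt l a)) \<le> ?b q) ?F"
      using ev
    proof eventually_elim
      fix q :: "real \<times> real" assume "q \<in> {0<..} \<times> UNIV"
      then have q: "fst q > 0" by auto
      note d = tilt_diff_bound[OF l q, THEN abs_le_D1, of _ "snd q" _ a]
        tilt_diff_bound[OF l q, THEN abs_le_D2, of _ "snd q" _ a]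
      have "log_mgf (tilt (fst q) (snd q)) \<le> log_mgf (tilt l a) + ?b q"
        by (intro log_mgf_mono_shift tilt_bm) (use d(1) in \<open>fastforce simp: algebra_simps\<close>)
      moreover have "log_mgf (tilt l a) \<le> log_mgf (tilt (fst q) (snd q)) + ?b q"
        by (intro log_mgf_mono_shift tilt_bm) (use d(2) in \<open>fastforce simp: algebra_simps\<close>)
      ultimately show "norm (log_mgf (tilt (fst q) (snd q)) - log_mgf (tilt l a)) \<le> ?b q"
        by (simp add: abs_le_iff)
    qed
    moreover have "(?b \<longlongrightarrow> 0) ?F"
    proof -
      have "(fst \<longlongrightarrow> l) ?F" "(snd \<longlongrightarrow> a) ?F"
        using tendsto_fst[OF tendsto_ident_at[of p]] tendsto_snd[OF tendsto_ident_at[of p]]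
        by (simp_all add: p)
      then have "(?b \<longlongrightarrow> \<bar>a - a\<bar> / (l * \<epsilon>) + (C + \<bar>a\<bar>) / \<epsilon> * \<bar>1 / l - 1 / l\<bar>) ?F"
        using l \<epsilon>_pos by (intro tendsto_intros) auto
      then show ?thesis by simp
    qed
    ultimately have "((\<lambda>q. log_mgf (tilt (fst q) (snd q)) - log_mgf (tilt l a)) \<longlongrightarrow> 0) ?F"
      by (rule Lim_null_comparison)
    then show "((\<lambda>q. log_mgf (tilt (fst q) (snd q))) \<longlongrightarrow> log_mgf (tilt (fst p) (snd p))) ?F"
      unfolding p fst_conv snd_conv by (rule LIM_zero_cancel)
  qed
  then show ?thesis unfolding dual_value_def case_prod_beta'
    by (intro continuous_intros)
qed

text \<open>
  The radius \<open>m\<close> minus the smallest regularized cost of any plan, which is attained by the Gibbs plan of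
  \<open>- c / \<epsilon>\<close>.
\<close>

definition slack :: real where
  "slack = m + \<epsilon> * log_mgf (\<lambda>z. - c z / \<epsilon>)"

lemma neg_cost_bm: "bounded_measurable (\<lambda>z. - c z / \<epsilon>)"
  using bounded_measurable_cmult[OF c_bm, of "- 1 / \<epsilon>"] by simp

lemma dual_value_ge:
  assumes l: "l > 0"
  shows "(1 - \<beta>) * a + l * slack \<le> dual_value l a"
proof -
  have "log_mgf (\<lambda>z. - c z / \<epsilon>) \<le> log_mgf (tilt l a) + 0"
    using l \<epsilon>_pos by (intro log_mgf_mono_shift tilt_bm neg_cost_bm) (auto simp: tilt_eq excess_def)
  then have "l * \<epsilon> * log_mgf (\<lambda>z. - c z / \<epsilon>) \<le> l * \<epsilon> * log_mgf (tilt l a)"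
    using l \<epsilon>_pos by (intro mult_left_mono) auto
  then show ?thesis by (simp add: dual_value_def slack_def algebra_simps)
qed

text \<open>
  Clamping confines \<open>a\<close> to \<open>[-C, C]\<close>, and positive slack makes the dual function grow linearly in \<open>l\<close>, so
  the minimum over a compact rectangle is global.
\<close>

lemma dual_value_attained:
  assumes slack: "slack > 0" and \<eta>: "\<eta> > 0"
  obtains l a where "l \<ge> \<eta>" "\<And>l' a'. l' \<ge> \<eta> \<Longrightarrow> dual_value l a \<le> dual_value l' a'"
proof -
  \<comment> \<open>Beyond \<open>L\<close> the linear lower bound on the dual value exceeds its value at \<open>(\<eta>, 0)\<close>.\<close>
  define L where "L = max \<eta> ((dual_value \<eta> 0 + (1 - \<beta>) * C) / slack)"
  let ?S = "{\<eta>..L} \<times> {- C..C}"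
  have ne: "(\<eta>, 0) \<in> ?S" using C_nonneg by (auto simp: L_def)
  have "continuous_on ?S (\<lambda>(l, a). dual_value l a)"
    by (rule continuous_on_subset[OF continuous_on_dual_value]) (use \<eta> in auto)
  then have "\<exists>p\<in>?S. \<forall>q\<in>?S. (\<lambda>(l, a). dual_value l a) p \<le> (\<lambda>(l, a). dual_value l a) q"
    by (intro continuous_attains_inf compact_Times compact_Icc) (use ne in blast)
  then obtain l a where la: "(l, a) \<in> ?S"
    and min: "\<And>l' a'. (l', a') \<in> ?S \<Longrightarrow> dual_value l a \<le> dual_value l' a'" by auto
  have "dual_value l a \<le> dual_value l' a'" if l': "l' \<ge> \<eta>" for l' a'
  proof -
    let ?a = "max (- C) (min a' C)"
    have a: "?a \<in> {- C..C}" using C_nonneg by auto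
    have "dual_value l a \<le> dual_value l' ?a"
    proof (cases "l' \<le> L")
      case True
      then show ?thesis using l' a by (intro min) auto
    next
      case False
      have "dual_value l a \<le> dual_value \<eta> 0" by (rule min[OF ne])
      also have "\<dots> \<le> - ((1 - \<beta>) * C) + L * slack"
      proof -
        have "(dual_value \<eta> 0 + (1 - \<beta>) * C) / slack \<le> L" by (simp add: L_def)
        then show ?thesis using slack by (simp add: field_simps)
      qed
      also have "\<dots> \<le> (1 - \<beta>) * ?a + l' * slack"
      proof (rule add_mono)
        have "(1 - \<beta>) * (- C) \<le> (1 - \<beta>) * ?a" using \<beta>_less_1 by (intro mult_left_mono) auto
        then show "- ((1 - \<beta>) * C) \<le> (1 - \<beta>) * ?a" by simp
      qed (use False slack in auto)
      also have "\<dots> \<le> dual_value l' ?a" using l' \<eta> by (intro dual_value_ge) auto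
      finally show ?thesis .
    qed
    also have "\<dots> \<le> dual_value l' a'" using l' \<eta> by (intro dual_value_clamp) auto
    finally show ?thesis .
  qed
  then show ?thesis using that la by auto
qed

text \<open>
  Comparison with \<open>(l + 1, a)\<close> shows that the Gibbs plan is feasible, and comparison with \<open>(\<eta>, b)\<close> bounds the
  complementary slackness term by \<open>\<eta> (m - J)\<close>, whether or not the multiplier sits at its lower bound.
\<close>

lemma near_optimal_plan:
  assumes slack: "slack > 0" and \<eta>: "\<eta> > 0"
  obtains l a \<pi> where "l > 0" "\<pi> \<in> transport_plans" "regularized_cost \<pi> \<le> ereal m"
    "\<And>b. dual_value l a \<le> primal_value \<pi> b + \<eta> * m"
proof -
  obtain l a where l: "l \<ge> \<eta>"
    and min: "\<And>l' a'. l' \<ge> \<eta> \<Longrightarrow> dual_value l a \<le> dual_value l' a'"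
    using dual_value_attained[OF assms] by blast
  let ?\<pi> = "gibbs (tilt l a)" and ?J = "gibbs_cost l a"
  note opt = first_order_optimality[OF \<eta> l min]
  have "?J \<le> m" using opt[of "l + 1" a] l \<eta> by simp
  then have "regularized_cost ?\<pi> \<le> ereal m" by (simp add: regularized_cost_gibbs_tilt)
  moreover have "dual_value l a \<le> primal_value ?\<pi> b + \<eta> * m" for b
  proof -
    have "dual_value l a = primal_value ?\<pi> a + l * (m - ?J)"
      using l \<eta> by (intro dual_value_eq_lagrangian) auto
    also have "\<dots> \<le> primal_value ?\<pi> b + \<eta> * (m - ?J)"
      using opt[of \<eta> b] by (simp add: algebra_simps)
    also have "\<dots> \<le> primal_value ?\<pi> b + \<eta> * m"
      using gibbs_cost_nonneg[of l a] \<eta> by (simp add: mult_left_mono)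
    finally show ?thesis .
  qed
  ultimately show ?thesis
    using l \<eta> by (intro that[of l ?\<pi> a] gibbs_transport_plan tilt_bm) auto
qed

text \<open>
  For a large multiplier the tilt is a small perturbation of \<open>- c / \<epsilon>\<close>, so the second-order bound around
  \<open>- c / \<epsilon>\<close> applies.
\<close>

lemma dual_value_le_large_multiplier:
  assumes l: "l > 0" and large: "(C + \<bar>a\<bar>) / (l * \<epsilon>) \<le> 1"
  shows "dual_value l a \<le> primal_value (gibbs (\<lambda>z. - c z / \<epsilon>)) a + l * slack + (C + \<bar>a\<bar>)\<^sup>2 / (l * \<epsilon>)"
proof -
  let ?k = "\<lambda>z. - c z / \<epsilon>"
  let ?d = "(C + \<bar>a\<bar>) / (l * \<epsilon>)"
  have diff: "tilt l a z - ?k z = excess a z / (l * \<epsilon>)" for z using l by (simp add: tilt_eq)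
  have "log_mgf (tilt l a) \<le> log_mgf ?k + (\<integral>z. tilt l a z - ?k z \<partial>gibbs ?k) + ?d\<^sup>2"
  proof (rule log_mgf_smooth[OF neg_cost_bm tilt_bm _ large])
    fix x y assume "y \<in> space B"
    then show "\<bar>tilt l a (x, y) - ?k (x, y)\<bar> \<le> ?d"
      unfolding diff using excess_bound[of y a x] l \<epsilon>_pos by (simp add: divide_right_mono)
  qed
  also have "(\<integral>z. tilt l a z - ?k z \<partial>gibbs ?k) = (\<integral>z. excess a z \<partial>gibbs ?k) / (l * \<epsilon>)"
    unfolding diff by simp
  finally have "l * \<epsilon> * log_mgf (tilt l a)
      \<le> l * \<epsilon> * (log_mgf ?k + (\<integral>z. excess a z \<partial>gibbs ?k) / (l * \<epsilon>) + ?d\<^sup>2)"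
    using l \<epsilon>_pos by (intro mult_left_mono) auto
  also have "\<dots> = l * \<epsilon> * log_mgf ?k + (\<integral>z. excess a z \<partial>gibbs ?k) + (C + \<bar>a\<bar>)\<^sup>2 / (l * \<epsilon>)"
    using l \<epsilon>_pos by (simp add: field_simps power2_eq_square)
  finally show ?thesis
    by (simp add: dual_value_def primal_value_def slack_def algebra_simps)
qed

lemma dual_value_unbounded_below:
  assumes "slack < 0"
  obtains l where "l > 0" "dual_value l a \<le> r"
proof -
  let ?p = "primal_value (gibbs (\<lambda>z. - c z / \<epsilon>)) a" and ?M = "C + \<bar>a\<bar>"
  have M: "?M \<ge> 0" using C_nonneg by simp
  \<comment> \<open>The second bound makes the tilt perturbation at most \<open>1\<close>; the third pushes the value below \<open>r\<close>.\<close>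
  define l where "l = max (max 1 (?M / \<epsilon>)) ((?p + ?M - r) / (- slack))"
  have l: "l \<ge> 1" "l \<ge> ?M / \<epsilon>" "l \<ge> (?p + ?M - r) / (- slack)" by (auto simp: l_def)
  have d: "?M / (l * \<epsilon>) \<le> 1" using l \<epsilon>_pos by (simp add: field_simps)
  have "?M\<^sup>2 / (l * \<epsilon>) = ?M * (?M / (l * \<epsilon>))" by (simp add: power2_eq_square)
  also have "\<dots> \<le> ?M" using mult_left_mono[OF d M] by simp
  finally have "dual_value l a \<le> ?p + l * slack + ?M"
    using dual_value_le_large_multiplier[of l a] l d by simp
  also have "\<dots> \<le> r"
  proof -
    have "- slack > 0" using assms by simp
    then have "?p + ?M - r \<le> l * (- slack)" using l(3) by (simp only: pos_divide_le_eq)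
    then show ?thesis by simp
  qed
  finally show ?thesis using that[of l] l by simp
qed

lemma dual_value_limit_zero_slack:
  assumes "slack = 0" and "\<delta> > 0"
  obtains l where "l > 0" "dual_value l a \<le> primal_value (gibbs (\<lambda>z. - c z / \<epsilon>)) a + \<delta>"
proof -
  let ?M = "C + \<bar>a\<bar>"
  define l where "l = max (max 1 (?M / \<epsilon>)) (?M\<^sup>2 / (\<delta> * \<epsilon>))"
  have l: "l \<ge> 1" "l \<ge> ?M / \<epsilon>" "l \<ge> ?M\<^sup>2 / (\<delta> * \<epsilon>)" by (auto simp: l_def)
  have d: "?M / (l * \<epsilon>) \<le> 1" using l \<epsilon>_pos by (simp add: field_simps)
  have "?M\<^sup>2 / (l * \<epsilon>) \<le> \<delta>" using l \<epsilon>_pos \<open>\<delta> > 0\<close> by (simp add: field_simps)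
  then show ?thesis
    using that[of l] dual_value_le_large_multiplier[of l a] l d assms by simp
qed

lemma regularized_cost_gibbs_neg_cost:
  "regularized_cost (gibbs (\<lambda>z. - c z / \<epsilon>)) = ereal (m - slack)"
proof -
  let ?k = "\<lambda>z. - c z / \<epsilon>"
  have "(\<integral>z. ?k z \<partial>gibbs ?k) = - (\<integral>z. c z \<partial>gibbs ?k) / \<epsilon>" by simp
  then show ?thesis
    unfolding regularized_cost_gibbs[OF neg_cost_bm] slack_def
    using \<epsilon>_pos by (simp add: right_diff_distrib)
qed

end

section \<open>Minimizers in the definition of conditional value at risk\<close>

text \<open>
  The objective is continuous and, as in the dual problem, monotone outside \<open>[-C, C]\<close>.
\<close>

lemma cvar_objective_attains_min:
  assumes Q: "prob_space Q" and f [measurable]: "f \<in> borel_measurable Q"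
    and C: "\<And>x. x \<in> space Q \<Longrightarrow> \<bar>f x\<bar> \<le> C" and \<beta>: "0 < \<beta>" "\<beta> < 1"
  shows "\<exists>a. \<forall>b. cvar_objective \<beta> f Q a \<le> cvar_objective \<beta> f Q b"
proof -
  interpret prob_space Q by (rule Q)
  define I where "I a = (\<integral>x. max (f x - a) 0 \<partial>Q)" for a
  have C0: "0 \<le> C" using C not_empty by fastforce
  have int: "integrable Q (\<lambda>x. max (f x - a) 0)" for a
    by (rule integrable_const_bound[of _ "C + \<bar>a\<bar>"])
      (use C C0 in \<open>force intro!: AE_I2 simp: abs_le_iff\<close>)+
  have shift: "I a \<le> I b + d" if "\<And>x. x \<in> space Q \<Longrightarrow> max (f x - a) 0 \<le> max (f x - b) 0 + d" for a b d
  proof -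
    have "I a \<le> (\<integral>x. max (f x - b) 0 + d \<partial>Q)"
      unfolding I_def using int that by (intro integral_mono) auto
    then show ?thesis using int by (simp add: I_def prob_space)
  qed
  let ?F = "\<lambda>a. (1 - \<beta>) * a + I a"
  have "continuous_on {- C..C} I"
  proof (rule continuous_onI)
    fix a e :: real assume "e > 0"
    moreover have "dist (I b) (I a) \<le> dist b a" for b
      using shift[of a b "\<bar>b - a\<bar>"] shift[of b a "\<bar>b - a\<bar>"] by (force simp: dist_real_def)
    ultimately show "\<exists>d>0. \<forall>b\<in>{- C..C}. dist b a < d \<longrightarrow> dist (I b) (I a) \<le> e"
      by (meson less_imp_le order_trans)
  qed
  then have "continuous_on {- C..C} ?F" by (intro continuous_intros)
  then have "\<exists>a\<in>{- C..C}. \<forall>b\<in>{- C..C}. ?F a \<le> ?F b"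
    using C0 by (intro continuous_attains_inf) auto
  then obtain a where min: "\<And>b. b \<in> {- C..C} \<Longrightarrow> ?F a \<le> ?F b" by blast
  have "?F a \<le> ?F b" for b
  proof -
    consider "b < - C" | "b \<in> {- C..C}" | "b > C" by fastforce
    then show ?thesis
    proof cases
      case 1
      have "I (- C) \<le> I b + (b + C)"
        by (rule shift) (use C 1 in \<open>fastforce simp: abs_le_iff\<close>)
      moreover have "\<beta> * (b + C) \<le> 0" using 1 \<beta> by (simp add: mult_le_0_iff)
      ultimately have "?F (- C) \<le> ?F b" by (simp add: algebra_simps)
      then show ?thesis using min[of "- C"] C0 by simp
    next
      case 3
      have "I C \<le> I b + 0"
        by (rule shift) (use C 3 in \<open>fastforce simp: abs_le_iff\<close>)
      moreover have "(1 - \<beta>) * C \<le> (1 - \<beta>) * b" using 3 \<beta> by simp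
      ultimately have "?F C \<le> ?F b" by simp
      then show ?thesis using min[of C] C0 by simp
    qed (rule min)
  qed
  moreover have "cvar_objective \<beta> f Q b = ?F b / (1 - \<beta>)" for b
    using \<beta> by (simp add: cvar_objective_def I_def add_divide_distrib)
  ultimately show ?thesis using \<beta> by (auto simp: divide_le_cancel)
qed

section \<open>The truncated Gaussian reference coupling\<close>

text \<open>
  Plans carry the Borel sets of the product set, while fibrewise integration works with the product of the
  two Borel structures; second countability identifies them.
\<close>

lemma sets_borel_of_Times:
  fixes X Y :: "'a::second_countable_topology set"
  shows "sets (borel_of (X \<times> Y)) = sets (borel_of X \<Otimes>\<^sub>M borel_of Y)"
proof
  have sp: "space (borel_of X \<Otimes>\<^sub>M borel_of Y) = space (borel_of (X \<times> Y))"
    by (simp add: space_pair_measure space_restrict_space)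
  have id1: "(\<lambda>z. z) \<in> borel_of X \<Otimes>\<^sub>M borel_of Y \<rightarrow>\<^sub>M borel_of (X \<times> Y)"
    using Pair_measurable_borel_of[of X Y] by (simp add: case_prod_beta')
  have "A \<in> sets (borel_of X \<Otimes>\<^sub>M borel_of Y)" if "A \<in> sets (borel_of (X \<times> Y))" for A
    using measurable_sets[OF id1 that] sets.sets_into_space[OF that] by (simp add: sp Int_absorb2)
  then show "sets (borel_of (X \<times> Y)) \<subseteq> sets (borel_of X \<Otimes>\<^sub>M borel_of Y)" by blast
  have 1: "fst \<in> borel_of (X \<times> Y) \<rightarrow>\<^sub>M borel_of X" and 2: "snd \<in> borel_of (X \<times> Y) \<rightarrow>\<^sub>M borel_of Y"
    by (intro measurable_restrict_space3;
        auto intro!: borel_measurable_continuous_onI continuous_intros)+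
  have id2: "(\<lambda>z. z) \<in> borel_of (X \<times> Y) \<rightarrow>\<^sub>M borel_of X \<Otimes>\<^sub>M borel_of Y"
    using measurable_Pair[OF 1 2] by simp
  have "A \<in> sets (borel_of (X \<times> Y))" if "A \<in> sets (borel_of X \<Otimes>\<^sub>M borel_of Y)" for A
    using measurable_sets[OF id2 that] sets.sets_into_space[OF that]
    by (simp add: Int_absorb2 flip: sp)
  then show "sets (borel_of X \<Otimes>\<^sub>M borel_of Y) \<subseteq> sets (borel_of (X \<times> Y))" by blast
qed

lemma nn_integral_ref_coupling:
  fixes \<Xi> :: "'a::euclidean_space set"
  assumes "compact \<Xi>" "emeasure lborel \<Xi> > 0" "P \<in> prob_measures \<Xi>"
    and g: "g \<in> borel_measurable (borel_of (\<Xi> \<times> \<Xi>))"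
  shows "(\<integral>\<^sup>+z. g z \<partial>ref_coupling \<sigma> \<Xi> P)
    = (\<integral>\<^sup>+\<xi>. (\<integral>\<^sup>+\<zeta>. g (\<xi>, \<zeta>) \<partial>gauss_kernel \<sigma> \<Xi> \<xi>) \<partial>P)"
proof -
  have sP: "sets P = sets (borel_of \<Xi>)" using assms(3) by (simp add: prob_measures_def)
  have spP: "space P = \<Xi>" using sets_eq_imp_space_eq[OF sP] by (simp add: space_restrict_space)
  have K: "(\<lambda>\<xi>. distr (gauss_kernel \<sigma> \<Xi> \<xi>) (borel_of (\<Xi> \<times> \<Xi>)) (\<lambda>\<zeta>. (\<xi>, \<zeta>)))
      \<in> P \<rightarrow>\<^sub>M subprob_algebra (borel_of (\<Xi> \<times> \<Xi>))"
    using ref_kernel_measurable[OF assms(1,2)] sP by (simp cong: measurable_cong_sets)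
  show ?thesis
    unfolding ref_coupling_def nn_integral_bind[OF g K]
    by (intro nn_integral_cong nn_integral_distr Pair_measurable_gauss_kernel assms)
      (simp_all add: spP g)
qed

locale gaussian_cvar_problem =
  fixes \<Xi> :: "'a::euclidean_space set" and f :: "'a \<Rightarrow> real" and P :: "'a measure"
    and \<beta> m \<epsilon> \<sigma> :: real
  assumes compact_\<Xi>: "compact \<Xi>" and \<Xi>_pos: "emeasure lborel \<Xi> > 0"
    and f_cont: "continuous_on \<Xi> f" and P_prob: "P \<in> prob_measures \<Xi>"
    and \<beta>: "0 < \<beta>" "\<beta> < 1" and \<epsilon>: "\<epsilon> > 0"
begin

definition f_sup :: real where "f_sup = (SUP y\<in>\<Xi>. \<bar>f y\<bar>)"

lemma f_sup_bound:
  assumes "y \<in> \<Xi>"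
  shows "\<bar>f y\<bar> \<le> f_sup"
proof -
  have "bounded ((\<lambda>y. \<bar>f y\<bar>) ` \<Xi>)"
    by (intro compact_imp_bounded compact_continuous_image compact_\<Xi> continuous_intros f_cont)
  then have "bdd_above ((\<lambda>y. \<bar>f y\<bar>) ` \<Xi>)" by (rule bounded_imp_bdd_above)
  then show ?thesis unfolding f_sup_def using assms by (rule cSUP_upper[rotated])
qed

lemma sets_P: "sets P = sets (borel_of \<Xi>)"
  using P_prob by (simp add: prob_measures_def)

lemma space_P: "space P = \<Xi>"
  using sets_eq_imp_space_eq[OF sets_P] by (simp add: space_restrict_space)

lemma sets_ref: "sets (ref_coupling \<sigma> \<Xi> P) = sets (borel_of (\<Xi> \<times> \<Xi>))"
  using ref_coupling_in_prob_measures[OF compact_\<Xi> \<Xi>_pos P_prob] by (simp add: prob_measures_def)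

lemma sets_pair: "sets (P \<Otimes>\<^sub>M borel_of \<Xi>) = sets (borel_of (\<Xi> \<times> \<Xi>))"
  by (simp add: sets_borel_of_Times sets_P cong: sets_pair_measure_cong)

sublocale kernel_coupling P "borel_of \<Xi>" "gauss_kernel \<sigma> \<Xi>" "ref_coupling \<sigma> \<Xi> P"
proof (rule kernel_coupling.intro)
  show "prob_space P" using P_prob by (simp add: prob_measures_def)
  have "gauss_kernel \<sigma> \<Xi> \<in> P \<rightarrow>\<^sub>M subprob_algebra (borel_of \<Xi>)"
    using gauss_kernel_measurable[OF compact_\<Xi> \<Xi>_pos] by (simp add: measurable_cong_sets[OF sets_P refl])
  then show "gauss_kernel \<sigma> \<Xi> \<in> P \<rightarrow>\<^sub>M prob_algebra (borel_of \<Xi>)"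
    using gauss_kernel_in_prob_measures[OF compact_\<Xi> \<Xi>_pos]
    by (intro measurable_prob_algebraI) (auto simp: prob_measures_def)
  show "sets (ref_coupling \<sigma> \<Xi> P) = sets (P \<Otimes>\<^sub>M borel_of \<Xi>)" by (simp add: sets_ref sets_pair)
  show "(\<integral>\<^sup>+z. g z \<partial>ref_coupling \<sigma> \<Xi> P) = (\<integral>\<^sup>+x. (\<integral>\<^sup>+y. g (x, y) \<partial>gauss_kernel \<sigma> \<Xi> x) \<partial>P)"
    if "g \<in> borel_measurable (P \<Otimes>\<^sub>M borel_of \<Xi>)" for g
    using that by (intro nn_integral_ref_coupling compact_\<Xi> \<Xi>_pos P_prob)
      (simp add: measurable_cong_sets[OF sets_pair refl])
qed

lemma bounded_measurable_continuous:
  assumes "continuous_on (\<Xi> \<times> \<Xi>) h"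
  shows "bounded_measurable h"
proof -
  have "h \<in> borel_measurable (P \<Otimes>\<^sub>M borel_of \<Xi>)"
    using continuous_on_borel_of_measurable[OF assms] by (simp add: measurable_cong_sets[OF sets_pair refl])
  moreover have "bounded (h ` (\<Xi> \<times> \<Xi>))"
    by (intro compact_imp_bounded compact_continuous_image compact_Times compact_\<Xi> assms)
  ultimately show ?thesis
    by (auto simp: bounded_measurable_def bounded_iff space_P space_restrict_space)
qed

lemma f_measurable: "f \<in> borel_measurable (borel_of \<Xi>)"
  by (rule continuous_on_borel_of_measurable[OF f_cont])

sublocale entropic_cvar_problem P "borel_of \<Xi>" "gauss_kernel \<sigma> \<Xi>" "ref_coupling \<sigma> \<Xi> P"
    "\<lambda>(\<xi>, \<zeta>). sq_dist_cost \<xi> \<zeta>" f f_sup \<epsilon> \<beta> m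
proof
  show "bounded_measurable (\<lambda>(\<xi>, \<zeta>). sq_dist_cost \<xi> \<zeta>)"
    unfolding sq_dist_cost_def case_prod_beta'
    by (intro bounded_measurable_continuous continuous_intros)
qed (use f_sup_bound f_measurable \<epsilon> \<beta> in \<open>auto simp: sq_dist_cost_def space_restrict_space\<close>)

lemma dual_objective_pos_eq:
  "dual_objective_pos \<beta> m \<epsilon> \<sigma> \<Xi> f P l a = dual_value l a / (1 - \<beta>)"
  using \<beta> by (simp add: dual_objective_pos_def dual_value_def log_mgf_def mgf_def tilt_def
      excess_def add_divide_distrib)

text \<open>
  The tilt is \<open>- c / \<epsilon>\<close> plus \<open>1 / l\<close> times a fixed function.
\<close>

lemma dual_objective_pos_converges:
  "\<exists>L. ((\<lambda>l. dual_objective_pos \<beta> m \<epsilon> \<sigma> \<Xi> f P l a) \<longlongrightarrow> L) (at_right 0)"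
proof -
  let ?k = "\<lambda>z. - (case z of (\<xi>, \<zeta>) \<Rightarrow> sq_dist_cost \<xi> \<zeta>) / \<epsilon>"
  obtain L where L: "((\<lambda>l. l * log_mgf (\<lambda>z. ?k z + excess a z / \<epsilon> / l)) \<longlongrightarrow> L) (at_right 0)"
    using scaled_log_mgf_converges[OF neg_cost_bm bounded_measurable_divide[OF excess_bm]] by blast
  have "((\<lambda>l. ((1 - \<beta>) * a + l * m + \<epsilon> * (l * log_mgf (\<lambda>z. ?k z + excess a z / \<epsilon> / l))) / (1 - \<beta>))
      \<longlongrightarrow> ((1 - \<beta>) * a + 0 * m + \<epsilon> * L) / (1 - \<beta>)) (at_right 0)"
    using \<beta> by (intro tendsto_intros L) auto
  moreover have "eventually (\<lambda>l. ((1 - \<beta>) * a + l * m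
        + \<epsilon> * (l * log_mgf (\<lambda>z. ?k z + excess a z / \<epsilon> / l))) / (1 - \<beta>)
      = dual_objective_pos \<beta> m \<epsilon> \<sigma> \<Xi> f P l a) (at_right 0)"
  proof (rule eventually_at_rightI[of 0 1])
    fix l :: real assume "l \<in> {0<..<1}"
    then have "tilt l a = (\<lambda>z. ?k z + excess a z / \<epsilon> / l)"
      by (intro ext) (simp add: tilt_eq mult.commute)
    then show "((1 - \<beta>) * a + l * m
        + \<epsilon> * (l * log_mgf (\<lambda>z. ?k z + excess a z / \<epsilon> / l))) / (1 - \<beta>)
      = dual_objective_pos \<beta> m \<epsilon> \<sigma> \<Xi> f P l a"
      by (simp add: dual_objective_pos_eq dual_value_def mult_ac)
  qed simp
  ultimately show ?thesis by (blast intro: Lim_transform_eventually)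
qed

text \<open>
  At \<open>l = 0\<close> the objective is a limit that exists, and it inherits lower bounds from positive multipliers.
\<close>

lemma dual_objective_lower_bound:
  assumes "\<And>l. l > 0 \<Longrightarrow> r \<le> dual_value l a / (1 - \<beta>)" and "l \<ge> 0"
  shows "r \<le> dual_objective \<beta> m \<epsilon> \<sigma> \<Xi> f P l a"
proof (cases "l = 0")
  case True
  obtain L where L: "((\<lambda>l. dual_objective_pos \<beta> m \<epsilon> \<sigma> \<Xi> f P l a) \<longlongrightarrow> L) (at_right 0)"
    using dual_objective_pos_converges by blast
  have "r \<le> L"
  proof (rule tendsto_lowerbound[OF L])
    show "eventually (\<lambda>l. r \<le> dual_objective_pos \<beta> m \<epsilon> \<sigma> \<Xi> f P l a) (at_right 0)"
      using assms(1) by (intro eventually_at_rightI[of 0 1]) (auto simp: dual_objective_pos_eq)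
  qed simp
  then show ?thesis using True tendsto_Lim[OF _ L] by (simp add: dual_objective_def)
qed (use assms in \<open>simp add: dual_objective_def dual_objective_pos_eq\<close>)

lemma transport_plan_iff:
  "\<pi> \<in> transport_plans \<longleftrightarrow> \<pi> \<in> prob_measures (\<Xi> \<times> \<Xi>) \<and> distr \<pi> (borel_of \<Xi>) fst = P"
proof -
  have "distr \<pi> P fst = distr \<pi> (borel_of \<Xi>) fst" for \<pi> :: "('a \<times> 'a) measure"
    by (rule distr_cong[OF refl sets_P refl])
  then show ?thesis by (auto simp: transport_plans_def prob_measures_def sets_ref)
qed

lemma snd_measurable_plan:
  "\<pi> \<in> transport_plans \<Longrightarrow> snd \<in> \<pi> \<rightarrow>\<^sub>M borel_of \<Xi>"
  by (simp add: transport_plans_def measurable_cong_sets[OF sets_R refl]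
      cong: measurable_cong_sets)

lemma cvar_objective_second_marginal:
  assumes \<pi>: "\<pi> \<in> transport_plans"
  shows "cvar_objective \<beta> f (distr \<pi> (borel_of \<Xi>) snd) a = primal_value \<pi> a / (1 - \<beta>)"
proof -
  have "(\<integral>x. max (f x - a) 0 \<partial>distr \<pi> (borel_of \<Xi>) snd) = (\<integral>z. excess a z \<partial>\<pi>)"
    unfolding excess_def
    by (rule integral_distr[OF snd_measurable_plan[OF \<pi>]]) (use f_measurable in measurable)
  then show ?thesis
    using \<beta> by (simp add: cvar_objective_def primal_value_def add_divide_distrib)
qed

lemma second_marginal_in_ambiguity_set:
  assumes \<pi>: "\<pi> \<in> transport_plans" and cost: "regularized_cost \<pi> \<le> ereal m"
  shows "distr \<pi> (borel_of \<Xi>) snd \<in> ambiguity_set \<sigma> \<epsilon> m \<Xi> P"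
proof -
  let ?Q = "distr \<pi> (borel_of \<Xi>) snd"
  have "prob_space ?Q"
    using \<pi> snd_measurable_plan[OF \<pi>] by (intro prob_space.prob_space_distr) (auto simp: transport_plans_def)
  then have Q: "?Q \<in> prob_measures \<Xi>" by (simp add: prob_measures_def)
  have "\<pi> \<in> couplings \<Xi> P ?Q" using \<pi> by (simp add: couplings_def transport_plan_iff)
  then have "entropic_wasserstein sq_dist_cost \<epsilon> (ref_coupling \<sigma> \<Xi> P) \<Xi> P ?Q \<le> regularized_cost \<pi>"
    unfolding entropic_wasserstein_def regularized_cost_def by (rule INF_lower)
  then show ?thesis using Q cost by (auto simp: ambiguity_set_def)
qed

text \<open>
  The Wasserstein value is an infimum over plans, so membership in the ambiguity set provides plans of cost
  at most \<open>m + \<delta>\<close> for each \<open>\<delta> > 0\<close>.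
\<close>

lemma ambiguity_set_plan:
  assumes Q: "Q \<in> ambiguity_set \<sigma> \<epsilon> m \<Xi> P" and \<delta>: "\<delta> > 0"
  obtains \<pi> where "\<pi> \<in> transport_plans" "distr \<pi> (borel_of \<Xi>) snd = Q"
    "regularized_cost \<pi> \<le> ereal (m + \<delta>)"
proof -
  have "entropic_wasserstein sq_dist_cost \<epsilon> (ref_coupling \<sigma> \<Xi> P) \<Xi> P Q < ereal (m + \<delta>)"
    using Q \<delta> by (auto simp: ambiguity_set_def intro: le_less_trans)
  then obtain \<pi> where "\<pi> \<in> couplings \<Xi> P Q" "regularized_cost \<pi> < ereal (m + \<delta>)"
    unfolding entropic_wasserstein_def regularized_cost_def INF_less_iff by blast
  then show ?thesis
    by (intro that[of \<pi>]) (auto simp: couplings_def transport_plan_iff)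
qed

lemma cvar_objective_le_dual_objective:
  assumes Q: "Q \<in> ambiguity_set \<sigma> \<epsilon> m \<Xi> P" and "l \<ge> 0"
  shows "cvar_objective \<beta> f Q a \<le> dual_objective \<beta> m \<epsilon> \<sigma> \<Xi> f P l a"
proof (rule dual_objective_lower_bound[OF _ \<open>l \<ge> 0\<close>])
  fix l :: real assume l: "l > 0"
  have "(1 - \<beta>) * cvar_objective \<beta> f Q a \<le> dual_value l a"
  proof (rule field_le_epsilon)
    fix e :: real assume "e > 0"
    then have "e / l > 0" using l by simp
    then obtain \<pi> where \<pi>: "\<pi> \<in> transport_plans" "distr \<pi> (borel_of \<Xi>) snd = Q"
      "regularized_cost \<pi> \<le> ereal (m + e / l)" using ambiguity_set_plan[OF Q] by blast
    have "(1 - \<beta>) * cvar_objective \<beta> f Q a = primal_value \<pi> a"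
      using cvar_objective_second_marginal[OF \<pi>(1), of a] \<pi>(2) \<beta> by simp
    also have "\<dots> \<le> dual_value l a + e"
      using weak_duality[OF \<pi>(1,3) l, of a] l by (simp add: dual_value_def algebra_simps)
    finally show "(1 - \<beta>) * cvar_objective \<beta> f Q a \<le> dual_value l a + e" .
  qed
  then show "cvar_objective \<beta> f Q a \<le> dual_value l a / (1 - \<beta>)"
    using \<beta> by (simp add: field_simps)
qed

abbreviation robust_value :: ereal where
  "robust_value \<equiv> (SUP Q \<in> ambiguity_set \<sigma> \<epsilon> m \<Xi> P. INF a. ereal (cvar_objective \<beta> f Q a))"

abbreviation dual_infimum :: ereal where
  "dual_infimum \<equiv> (INF (l, a) \<in> {0..} \<times> UNIV. ereal (dual_objective \<beta> m \<epsilon> \<sigma> \<Xi> f P l a))"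

lemma dual_infimum_le: "l > 0 \<Longrightarrow> dual_infimum \<le> ereal (dual_value l a / (1 - \<beta>))"
  by (rule INF_lower2[of "(l, a)"]) (auto simp: dual_objective_def dual_objective_pos_eq)

lemma robust_value_ge:
  assumes \<pi>: "\<pi> \<in> transport_plans" and cost: "regularized_cost \<pi> \<le> ereal m"
    and ge: "\<And>a. r \<le> ereal (primal_value \<pi> a / (1 - \<beta>))"
  shows "r \<le> robust_value"
  by (rule SUP_upper2[OF second_marginal_in_ambiguity_set[OF \<pi> cost]], rule INF_greatest)
    (use ge in \<open>simp add: cvar_objective_second_marginal[OF \<pi>]\<close>)

text \<open>
  If \<open>m\<close> is below the least cost of a plan, the dual is unbounded below; if \<open>m\<close> equals it, the dual
  approaches the value of the cheapest plan as the multiplier grows; if \<open>m\<close> exceeds it,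
  \<open>near_optimal_plan\<close> applies.
\<close>

lemma strong_duality: "dual_infimum \<le> robust_value"
proof -
  consider "slack < 0" | "slack = 0" | "slack > 0" by linarith
  then show ?thesis
  proof cases
    case 1
    have "dual_infimum \<le> ereal r" for r
    proof -
      obtain l where l: "l > 0" "dual_value l 0 \<le> r * (1 - \<beta>)"
        using dual_value_unbounded_below[OF 1] by blast
      have "dual_infimum \<le> ereal (dual_value l 0 / (1 - \<beta>))" by (rule dual_infimum_le[OF l(1)])
      also have "\<dots> \<le> ereal r" using l(2) \<beta> by (simp add: pos_divide_le_eq)
      finally show ?thesis .
    qed
    then have "dual_infimum = - \<infinity>" by (rule ereal_bot)
    then show ?thesis by simp
  next
    case 2
    let ?\<pi> = "gibbs (\<lambda>z. - (case z of (\<xi>, \<zeta>) \<Rightarrow> sq_dist_cost \<xi> \<zeta>) / \<epsilon>)"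
    show ?thesis
    proof (rule robust_value_ge)
      show "?\<pi> \<in> transport_plans" by (rule gibbs_transport_plan[OF neg_cost_bm])
      show "regularized_cost ?\<pi> \<le> ereal m" unfolding regularized_cost_gibbs_neg_cost 2 by simp
      fix a
      show "dual_infimum \<le> ereal (primal_value ?\<pi> a / (1 - \<beta>))"
      proof (rule ereal_le_epsilon2)
        fix e :: real assume "e > 0"
        then have "e * (1 - \<beta>) > 0" using \<beta> by simp
        then obtain l where l: "l > 0" "dual_value l a \<le> primal_value ?\<pi> a + e * (1 - \<beta>)"
          using dual_value_limit_zero_slack[OF 2] by blast
        have "dual_infimum \<le> ereal (dual_value l a / (1 - \<beta>))" by (rule dual_infimum_le[OF l(1)])
        also have "\<dots> \<le> ereal ((primal_value ?\<pi> a + e * (1 - \<beta>)) / (1 - \<beta>))"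
          using l(2) \<beta> by (simp add: divide_right_mono)
        also have "\<dots> = ereal (primal_value ?\<pi> a / (1 - \<beta>)) + ereal e"
          using \<beta> by (simp add: add_divide_distrib)
        finally show "dual_infimum \<le> ereal (primal_value ?\<pi> a / (1 - \<beta>)) + ereal e" .
      qed
    qed
  next
    case 3
    show ?thesis
    proof (rule ereal_le_epsilon2)
      fix e :: real assume e: "e > 0"
      \<comment> \<open>The absolute value and the \<open>1\<close> keep the denominator positive for every real \<open>m\<close>.\<close>
      define \<eta> where "\<eta> = e * (1 - \<beta>) / (\<bar>m\<bar> + 1)"
      have \<eta>: "\<eta> > 0" using e \<beta> by (simp add: \<eta>_def)
      have \<eta>m: "\<eta> * m \<le> e * (1 - \<beta>)"
      proof -
        have "\<eta> * m \<le> \<eta> * (\<bar>m\<bar> + 1)" using \<eta> by (intro mult_left_mono) auto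
        also have "\<dots> = e * (1 - \<beta>)" by (simp add: \<eta>_def)
        finally show ?thesis .
      qed
      obtain l a \<pi> where l: "l > 0" and \<pi>: "\<pi> \<in> transport_plans" "regularized_cost \<pi> \<le> ereal m"
        and near: "\<And>b. dual_value l a \<le> primal_value \<pi> b + \<eta> * m"
        by (rule near_optimal_plan[OF 3 \<eta>]) (rule that, auto)
      have le: "dual_value l a \<le> primal_value \<pi> b + e * (1 - \<beta>)" for b
        using near[of b] \<eta>m by linarith
      have "ereal (dual_value l a / (1 - \<beta>) - e) \<le> robust_value"
      proof (rule robust_value_ge[OF \<pi>])
        fix b
        have "dual_value l a / (1 - \<beta>) \<le> (primal_value \<pi> b + e * (1 - \<beta>)) / (1 - \<beta>)"
          using le[of b] \<beta> by (simp add: divide_right_mono)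
        then show "ereal (dual_value l a / (1 - \<beta>) - e) \<le> ereal (primal_value \<pi> b / (1 - \<beta>))"
          using \<beta> by (simp add: add_divide_distrib)
      qed
      then have "ereal (dual_value l a / (1 - \<beta>) - e) + ereal e \<le> robust_value + ereal e"
        by (rule add_right_mono)
      then show "dual_infimum \<le> robust_value + ereal e"
        using dual_infimum_le[OF l, of a] by simp
    qed
  qed
qed

lemma cvar_duality: "robust_value = dual_infimum"
proof (rule antisym[OF _ strong_duality])
  show "robust_value \<le> dual_infimum"
    by (auto intro!: SUP_least INF_greatest INF_lower2 cvar_objective_le_dual_objective)
qed

lemma cvar_attained:
  assumes "Q \<in> ambiguity_set \<sigma> \<epsilon> m \<Xi> P"
  shows "\<exists>a. \<forall>b. cvar_objective \<beta> f Q a \<le> cvar_objective \<beta> f Q b"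
proof -
  have Q: "prob_space Q" "sets Q = sets (borel_of \<Xi>)"
    using assms by (auto simp: ambiguity_set_def prob_measures_def)
  have "space Q = \<Xi>" using sets_eq_imp_space_eq[OF Q(2)] by (simp add: space_restrict_space)
  then show ?thesis
    using f_sup_bound f_measurable \<beta>
    by (intro cvar_objective_attains_min[OF Q(1), of _ f_sup])
      (auto simp: measurable_cong_sets[OF Q(2) refl])
qed

end

theorem proposition2p4:
  fixes \<Xi> :: "(real ^ 'k) set" and f :: "real ^ 'k \<Rightarrow> real" and P :: "(real ^ 'k) measure"
    and \<beta> m \<epsilon> \<sigma> :: real
  assumes "compact \<Xi>" and "emeasure lborel \<Xi> > 0"
    and "continuous_on \<Xi> f"
    and "P \<in> prob_measures \<Xi>"
    and "0 < \<beta>" and "\<beta> < 1" and "m > 0" and "\<epsilon> > 0" and "\<sigma> > 0"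
  shows "(\<forall>Q \<in> ambiguity_set \<sigma> \<epsilon> m \<Xi> P.
            \<exists>\<alpha>\<^sub>0. \<forall>\<alpha>. cvar_objective \<beta> f Q \<alpha>\<^sub>0 \<le> cvar_objective \<beta> f Q \<alpha>)
       \<and> (SUP Q \<in> ambiguity_set \<sigma> \<epsilon> m \<Xi> P. INF \<alpha>. ereal (cvar_objective \<beta> f Q \<alpha>))
         = (INF (l, \<alpha>) \<in> {0..} \<times> UNIV. ereal (dual_objective \<beta> m \<epsilon> \<sigma> \<Xi> f P l \<alpha>))"
proof -
  interpret gaussian_cvar_problem \<Xi> f P \<beta> m \<epsilon> \<sigma>
    using assms by unfold_locales
  show ?thesis using cvar_attained cvar_duality by blast
qed

end
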